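(* Let $p>0$, $\ell\in\{1,2\}$ and let $k>2$ be an integer. Then for $z\in\mathbb{C}$, $z\neq0$, $$\mathscr{P}_k^{(\ell,p)}(z)-z^{2k-2}\mathscr{P}_k^{(\ell,p)}\left(\frac1z\right)=0,$$ and for $z\in\mathbb{C}$, $z\ne 0,1$, $$\mathscr{P}_k^{(\ell,p)}(z)-\mathscr{P}_k^{(\ell,p)}(z-1)+z^{2k-2}\mathscr{P}_k^{(\ell,p)}\left(\frac{z-1}{z}\right)=\mathcal{E}^{(\ell,p)}(z),$$ where $\mathcal{E}^{(\ell,p)}(x)$ denotes the coefficient of $t^{2k}$ in the power series expansion in $t$ (around $t=0$) of $\mathcal{E}^{(\ell,p)}(x,t)$, with $$\mathcal{E}^{(1,p)}(x,t):=\frac{x(1-x)t^5e^{xt}}{4\pi^3 f_p(t)f_p(xt)f_p((x-1)t)},\qquad f_p(y):=(e^y-1)\left(p+\frac{y}{2\pi}\right)+\frac y\pi,$$ and $$\mathcal{E}^{(2,p)}(x,t):=t^2\bigl\{\sigma_p(xt)\sigma_p(t)-\sigma_p((x-1)t)\sigma_p(t)+\sigma_p((x-1)t)\sigma_p(xt)\bigr\}.$$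
   Context: Fix a real number $p>0$. Let $0<\lambda_1<\lambda_2<\cdots$ be the positive roots of $p\sin(\pi\lambda)+\lambda\cos(\pi\lambda)=0$, and put $$\sigma(x):=\frac{p+x}{p-x},\qquad \sigma_p(t):=\sum_{j=1}^\infty\frac{p^2+\lambda_j^2}{p\left(p+\frac1\pi\right)+\lambda_j^2}e^{-\lambda_jt}\quad(\mathrm{Re}(t)>0).$$ The $p$-Bernoulli numbers of the first kind $B_n^{(1,p)}$ and of the second kind $B_n^{(2,p)}$ ($n\ge0$) are given by the generating functions $$\sum_{n=0}^\infty\frac{B_n^{(1,p)}}{n!}t^n=\frac{t}{\sigma\left(\frac{t}{2\pi}\right)e^t-1},\qquad \sum_{n=0}^\infty\frac{B_n^{(2,p)}}{n!}t^n=t\,\sigma_p(t)$$ near $t=0$ (the second one for $0<t<1$). Through the second identity $\sigma_p$ is continued meromorphically to a neighbourhood of $t=0$ (with a simple pole at $0$), and this continuation is used in $\mathcal{E}^{(2,p)}(x,t)$. For $k\ge1$ and $\ell=1,2$ define the rational function $$\mathscr{P}_k^{(\ell,p)}(z):=\sum_{j=0}^{2k}\frac{B_j^{(\ell,p)}B_{2k-j}^{(\ell,p)}}{j!\,(2k-j)!}z^{j-1}.$$ *)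

theory Defs
  imports "HOL-Complex_Analysis.Complex_Analysis"
begin

text \<open>Counting starts at 0: \<open>pos_root p j\<close> is the root usually written
  \<open>\<lambda>\<close> with index \<open>j + 1\<close>.\<close>

definition pos_root :: "real \<Rightarrow> nat \<Rightarrow> real" where
  "pos_root p = (THE lam. strict_mono lam \<and>
     range lam = {x. x > 0 \<and> p * sin (pi * x) + x * cos (pi * x) = 0})"

definition sigma_frac :: "real \<Rightarrow> complex \<Rightarrow> complex" where
  "sigma_frac p x = (of_real p + x) / (of_real p - x)"

definition sigma_p :: "real \<Rightarrow> complex \<Rightarrow> complex" where
  "sigma_p p t = (\<Sum>j. of_real ((p^2 + (pos_root p j)^2) / (p * (p + 1 / pi) + (pos_root p j)^2))
     * exp (- of_real (pos_root p j) * t))"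

text \<open>The generating function below is undefined at \<open>t = 0\<close>, where it has a
  removable singularity. The Laurent expansion at 0 depends only on the values at
  \<open>t \<noteq> 0\<close>, so it is the power series of the continuous extension and is not
  affected by \<open>0 / 0 = 0\<close>.\<close>

definition p_bernoulli1 :: "real \<Rightarrow> nat \<Rightarrow> complex" where
  "p_bernoulli1 p n = fact n *
     fls_nth (laurent_expansion (\<lambda>t. t / (sigma_frac p (t / (2 * of_real pi)) * exp t - 1)) 0) (int n)"

definition p_bernoulli2 :: "real \<Rightarrow> nat \<Rightarrow> complex" where
  "p_bernoulli2 p = (THE B. \<forall>t::real. 0 < t \<and> t < 1 \<longrightarrow>
     (\<lambda>n. B n / fact n * of_real t ^ n) sums (of_real t * sigma_p p (of_real t)))"

definition p_bernoulli :: "nat \<Rightarrow> real \<Rightarrow> nat \<Rightarrow> complex" where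
  "p_bernoulli l p n = (if l = 1 then p_bernoulli1 p n else p_bernoulli2 p n)"

text \<open>The meromorphic continuation of \<open>sigma_p p\<close> to a neighbourhood of 0;
  \<open>sigma_p p\<close> itself is only meaningful for \<open>Re t > 0\<close>.\<close>

definition sigma_p_cont :: "real \<Rightarrow> complex \<Rightarrow> complex" where
  "sigma_p_cont p t = (\<Sum>n. p_bernoulli2 p n / fact n * t ^ n) / t"

definition P_fun :: "nat \<Rightarrow> real \<Rightarrow> nat \<Rightarrow> complex \<Rightarrow> complex" where
  "P_fun l p k z = (\<Sum>j=0..2*k. p_bernoulli l p j * p_bernoulli l p (2*k - j)
     / (fact j * fact (2*k - j)) * z powi (int j - 1))"

definition f_fun :: "real \<Rightarrow> complex \<Rightarrow> complex" where
  "f_fun p y = (exp y - 1) * (of_real p + y / (2 * of_real pi)) + y / of_real pi"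

definition E1_gen :: "real \<Rightarrow> complex \<Rightarrow> complex \<Rightarrow> complex" where
  "E1_gen p x t = x * (1 - x) * t^5 * exp (x * t)
     / (4 * of_real pi ^ 3 * f_fun p t * f_fun p (x * t) * f_fun p ((x - 1) * t))"

definition E2_gen :: "real \<Rightarrow> complex \<Rightarrow> complex \<Rightarrow> complex" where
  "E2_gen p x t = t^2 *
     (sigma_p_cont p (x * t) * sigma_p_cont p t
      - sigma_p_cont p ((x - 1) * t) * sigma_p_cont p t
      + sigma_p_cont p ((x - 1) * t) * sigma_p_cont p (x * t))"

definition E_gen :: "nat \<Rightarrow> real \<Rightarrow> complex \<Rightarrow> complex \<Rightarrow> complex" where
  "E_gen l p x t = (if l = 1 then E1_gen p x t else E2_gen p x t)"

text \<open>As a function of \<open>t\<close>, \<open>E_gen l p x\<close> has a removable singularity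
  at 0 for \<open>x \<noteq> 0, 1\<close>, so its Laurent expansion is a power series.\<close>

definition E_coeff :: "nat \<Rightarrow> real \<Rightarrow> nat \<Rightarrow> complex \<Rightarrow> complex" where
  "E_coeff l p k x = fls_nth (laurent_expansion (E_gen l p x) 0) (int (2 * k))"

end

theory Submission
  imports Defs
begin

text \<open>
  Write \<open>\<sigma>\<close> for \<open>\<phi>(t) / t\<close>, where \<open>\<phi>\<close> is the exponential generating function of the
  \<open>p\<close>-Bernoulli numbers. The product \<open>\<sigma>(a t) \<sigma>(b t) t\<^sup>2\<close> is a power series, and its
  coefficient at \<open>t\<^sup>2\<^sup>k\<close> is \<open>b\<^sup>2\<^sup>k\<^sup>-\<^sup>2 P(a / b)\<close> (\<open>dilated_product_egf_nth\<close>). So \<open>P\<close> is a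
  dehomogenized bilinear form in \<open>(a, b)\<close>: exchanging \<open>a\<close> and \<open>b\<close> gives the first functional
  equation, and the left side of the second one is the coefficient of the three-term expression
  \<open>\<sigma>(x t) \<sigma>(t) - \<sigma>((x - 1) t) \<sigma>(t) + \<sigma>((x - 1) t) \<sigma>(x t)\<close> times \<open>t\<^sup>2\<close>
  (\<open>three_term_expansion\<close>).

  For the first kind, \<open>\<sigma> = 1 / (W - 1)\<close> with \<open>W(t) = sigma_frac p (t / 2\<pi>) e\<^sup>t\<close>. If \<open>W\<close>
  were multiplicative, the three-term expression would equal \<open>- \<sigma>(x t)\<close>; the rational factor of \<open>W\<close> fails to be multiplicative by an explicit amount, which is
  the error term (\<open>sigma1_addition\<close>). The leftover \<open>- \<sigma>(x t)\<close> is invisible in the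
  coefficients in question, because \<open>W(-t) = 1 / W(t)\<close> makes \<open>\<sigma> + 1/2\<close> odd
  (\<open>egf_first_kind_odd\<close>).

  For the second kind the error term is the three-term expression by definition. What has to be
  proved is that the numbers exist at all, that is, that \<open>t \<sigma>\<^sub>p(t)\<close> extends holomorphically to the
  unit disc (\<open>egf_second_kind\<close>). The weights in \<open>\<sigma>\<^sub>p\<close> are \<open>\<pi>\<close> times the residues of \<open>h / g\<close>, where
  \<open>g(s) = p sin \<pi>s + s cos \<pi>s\<close> vanishes at the \<open>\<lambda>\<close>'s and
  \<open>h(s) = p cos \<pi>s - s sin \<pi>s\<close>. In the upper half-plane \<open>h / g = - \<i> + u\<close>, where \<open>u\<close> is of size
  \<open>e\<^sup>-\<^sup>2\<^sup>\<pi>\<^sup>y\<close> with \<open>y = Im s\<close>. The residue theorem on growing rectangles with left side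
  \<open>Re s = 1/4\<close> turns the partial sums into contour integrals of \<open>h / g\<close> times \<open>e\<^sup>-\<^sup>s\<^sup>t\<close>; the
  constant \<open>- \<i>\<close> is integrated in closed form and yields the pole \<open>e\<^sup>-\<^sup>t\<^sup>/\<^sup>4 / t\<close>, and in the limit
  only the integral of \<open>u(s) e\<^sup>-\<^sup>s\<^sup>t\<close> over the ray \<open>1/4 + \<i> y\<close> remains (\<open>upper_contour_limit\<close>).
  The exponential decay of \<open>u\<close> makes it holomorphic in \<open>t\<close> near \<open>0\<close>
  (\<open>ray_integral_holomorphic\<close>), whereas the series itself only converges for \<open>Re t > 0\<close>.
\<close>

section \<open>Products of dilated generating functions\<close>

definition egf :: "nat \<Rightarrow> real \<Rightarrow> complex fps" where
  "egf l p = Abs_fps (\<lambda>n. p_bernoulli l p n / fact n)"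

text \<open>
  The power series of \<open>t\<^sup>2 \<sigma>(a t) \<sigma>(b t)\<close> for \<open>\<sigma>(t) = F(t) / t\<close>.
\<close>

definition dilated_product :: "complex fps \<Rightarrow> complex \<Rightarrow> complex \<Rightarrow> complex fps" where
  "dilated_product F a b = fps_const (1 / (a * b)) *
     ((F oo (fps_const a * fps_X)) * (F oo (fps_const b * fps_X)))"

lemma has_fps_expansion_dilated_product:
  assumes "f has_fps_expansion F"
  shows "(\<lambda>t. f (a * t) * f (b * t) / (a * b)) has_fps_expansion dilated_product F a b"
proof -
  have dil: "(\<lambda>t. f (c * t)) has_fps_expansion (F oo (fps_const c * fps_X))" for c
    using has_fps_expansion_compose[OF assms, of "\<lambda>t. c * t" "fps_const c * fps_X"]
    by (simp add: o_def fps_expansion_intros)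
  have "(\<lambda>t. 1 / (a * b) * (f (a * t) * f (b * t))) has_fps_expansion dilated_product F a b"
    unfolding dilated_product_def by (intro fps_expansion_intros dil)
  then show ?thesis by simp
qed

text \<open>
  The \<open>j\<close>-th summand of the Cauchy product carries \<open>a\<^sup>j\<^sup>-\<^sup>1 b\<^sup>2\<^sup>k\<^sup>-\<^sup>j\<^sup>-\<^sup>1\<close>, which is homogeneous of degree
  \<open>2k - 2\<close>.
\<close>

lemma dilated_product_egf_nth:
  assumes "a \<noteq> 0" "b \<noteq> 0" "k \<ge> 1"
  shows "fps_nth (dilated_product (egf l p) a b) (2 * k) = b ^ (2 * k - 2) * P_fun l p k (a / b)"
proof -
  have weight: "a ^ i * b ^ (2 * k - i) / (a * b) = b ^ (2 * k - 2) * (a / b) powi (int i - 1)"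
    if "i \<le> 2 * k" for i
  proof -
    have "b ^ (2 * k - i) = b ^ (2 * k) / b ^ i"
      using that assms(2) by (simp add: power_diff)
    moreover have "b ^ (2 * k - 2) = b ^ (2 * k) / b\<^sup>2"
      using assms by (intro power_diff) auto
    moreover have "(a / b) powi (int i - 1) = (a / b) ^ i / (a / b)"
      using assms by (simp add: power_int_diff)
    ultimately show ?thesis
      using assms by (simp add: power_divide power2_eq_square mult_ac)
  qed
  have "fps_nth (dilated_product (egf l p) a b) (2 * k) =
    (\<Sum>i=0..2*k. a ^ i * b ^ (2 * k - i) / (a * b) *
       (p_bernoulli l p i * p_bernoulli l p (2 * k - i) / (fact i * fact (2 * k - i))))"
  proof -
    have "fps_nth (dilated_product (egf l p) a b) (2 * k) = 1 / (a * b) *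
      (\<Sum>i=0..2*k. a ^ i * (p_bernoulli l p i / fact i)
         * (b ^ (2 * k - i) * (p_bernoulli l p (2 * k - i) / fact (2 * k - i))))"
      by (simp only: dilated_product_def fps_mult_left_const_nth fps_compose_linear egf_def
                     fps_mult_nth [where f = "Abs_fps _"] fps_nth_Abs_fps)
    then show ?thesis
      by (simp only: sum_distrib_left) (simp add: mult_ac)
  qed
  also have "\<dots> = (\<Sum>i=0..2*k. b ^ (2 * k - 2) * (a / b) powi (int i - 1) *
       (p_bernoulli l p i * p_bernoulli l p (2 * k - i) / (fact i * fact (2 * k - i))))"
    by (intro sum.cong refl) (simp only: weight atLeastAtMost_iff)
  also have "\<dots> = b ^ (2 * k - 2) * P_fun l p k (a / b)"
    by (simp add: P_fun_def sum_distrib_left mult_ac)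
  finally show ?thesis .
qed

text \<open>
  The dilated product is symmetric in the two dilation factors.
\<close>

lemma P_fun_reciprocal:
  assumes "z \<noteq> 0" "k \<ge> 1"
  shows "P_fun l p k z - z ^ (2 * k - 2) * P_fun l p k (1 / z) = 0"
proof -
  have "dilated_product (egf l p) z 1 = dilated_product (egf l p) 1 z"
    by (simp add: dilated_product_def mult_ac)
  then show ?thesis
    using dilated_product_egf_nth[of z 1 k l p] dilated_product_egf_nth[of 1 z k l p] assms
    by simp
qed

text \<open>
  For \<open>s = sigma_p_cont p\<close> this is \<open>E2_gen\<close>, and for \<open>s = \<phi>(t) / t\<close> its expansion contains the
  left side of the three-term functional equation.
\<close>

definition three_term :: "(complex \<Rightarrow> complex) \<Rightarrow> complex \<Rightarrow> complex \<Rightarrow> complex" where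
  "three_term s x t = t\<^sup>2 * (s (x * t) * s t - s ((x - 1) * t) * s t + s ((x - 1) * t) * s (x * t))"

lemma three_term_expansion:
  assumes f: "f has_fps_expansion egf l p" and x: "x \<noteq> 0" "x \<noteq> 1" and k: "k \<ge> 1"
  obtains H where "three_term (\<lambda>t. f t / t) x has_laurent_expansion fps_to_fls H"
    "fps_nth H (2 * k) = P_fun l p k x - P_fun l p k (x - 1)
       + x ^ (2 * k - 2) * P_fun l p k ((x - 1) / x)"
proof
  let ?D = "dilated_product (egf l p)"
  let ?H = "?D x 1 - ?D (x - 1) 1 + ?D (x - 1) x"
  let ?h = "\<lambda>a b t. f (a * t) * f (b * t) / (a * b)"
  have "(\<lambda>t. ?h x 1 t - ?h (x - 1) 1 t + ?h (x - 1) x t) has_laurent_expansion fps_to_fls ?H"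
    by (intro has_laurent_expansion_fps fps_expansion_intros has_fps_expansion_dilated_product f)
  also have "?this \<longleftrightarrow> three_term (\<lambda>t. f t / t) x has_laurent_expansion fps_to_fls ?H"
  proof (intro has_laurent_expansion_cong refl)
    have "?h x 1 t - ?h (x - 1) 1 t + ?h (x - 1) x t = three_term (\<lambda>t. f t / t) x t"
      if "t \<noteq> 0" for t
    proof -
      have summand: "t\<^sup>2 * (f (a * t) / (a * t) * (f (b * t) / (b * t))) = ?h a b t" for a b
        using that by (simp add: power2_eq_square)
      show ?thesis
        using summand[of x 1] summand[of "x - 1" 1] summand[of "x - 1" x]
        unfolding three_term_def by (simp only: distrib_left right_diff_distrib mult_1)
    qed
    then show "\<forall>\<^sub>F t in at 0. ?h x 1 t - ?h (x - 1) 1 t + ?h (x - 1) x t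
        = three_term (\<lambda>t. f t / t) x t"
      by (simp add: eventually_at_filter)
  qed
  finally show "three_term (\<lambda>t. f t / t) x has_laurent_expansion fps_to_fls ?H" .
  show "fps_nth ?H (2 * k) = P_fun l p k x - P_fun l p k (x - 1)
       + x ^ (2 * k - 2) * P_fun l p k ((x - 1) / x)"
    using x k dilated_product_egf_nth[of x 1 k l p] dilated_product_egf_nth[of "x - 1" 1 k l p]
      dilated_product_egf_nth[of "x - 1" x k l p]
    by simp
qed

section \<open>The first kind: a failed addition theorem\<close>

definition sigma1 :: "real \<Rightarrow> complex \<Rightarrow> complex" where
  "sigma1 p t = (of_real p - t / (2 * of_real pi)) / f_fun p t"

text \<open>
  Clearing the denominator of \<open>sigma_frac\<close> produces the function \<open>f_fun\<close> of the error
  term.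
\<close>

lemma sigma1_eq:
  assumes "t / (2 * of_real pi) \<noteq> of_real p"
  shows "1 / (sigma_frac p (t / (2 * of_real pi)) * exp t - 1) = sigma1 p t"
proof -
  define y where "y = t / (2 * of_real pi)"
  have t: "t / of_real pi = 2 * y"
    by (simp add: y_def)
  have "sigma_frac p y * exp t - 1 = f_fun p t / (of_real p - y)"
    using assms
    by (simp add: sigma_frac_def f_fun_def t flip: y_def) (simp add: field_simps)
  then show ?thesis
    by (simp add: sigma1_def y_def)
qed

lemma f_fun_minus: "f_fun p (- t) = - exp (- t) * f_fun p t"
proof -
  define y where "y = t / (2 * of_real pi)"
  have "f_fun p t = (exp t - 1) * (of_real p + y) + 2 * y"
    "f_fun p (- t) = (exp (- t) - 1) * (of_real p - y) - 2 * y"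
    by (simp_all add: y_def f_fun_def)
  moreover have "exp (- t) * exp t = 1"
    by (simp flip: exp_add)
  ultimately show ?thesis
    by algebra
qed

text \<open>
  With \<open>\<sigma> = 1 / (W - 1)\<close> this is \<open>W(-t) = 1 / W(t)\<close>.
\<close>

lemma sigma1_minus:
  assumes "f_fun p t \<noteq> 0"
  shows "sigma1 p (- t) = - 1 - sigma1 p t"
proof -
  define y where "y = t / (2 * of_real pi)"
  have f: "f_fun p t = (exp t - 1) * (of_real p + y) + 2 * y"
    by (simp add: y_def f_fun_def)
  have "(of_real p + y) * exp t = f_fun p t + (of_real p - y)"
    unfolding f by algebra
  then have "(of_real p + y) / (exp (- t) * f_fun p t) = 1 + (of_real p - y) / f_fun p t"
    using assms by (simp add: exp_minus field_simps)
  then show ?thesis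
    using assms by (simp add: sigma1_def f_fun_minus flip: y_def)
qed

text \<open>
  Multiplied by \<open>f_fun p t * f_fun p (x * t) * f_fun p ((x - 1) * t)\<close>, both sides become
  polynomials in \<open>p\<close>, \<open>x\<close>, \<open>y = t / 2\<pi>\<close> and the two exponentials \<open>e\<^sup>t\<close>, \<open>e\<^sup>(\<^sup>x\<^sup>-\<^sup>1\<^sup>)\<^sup>t\<close>, and
  \<open>e\<^sup>x\<^sup>t\<close> is the product of those two. The cubic term
  \<open>2 x (1 - x) y\<^sup>3\<close> is the sum of \<open>(p + A) (p + B) (p - A - B)\<close> and its image under
  \<open>p \<mapsto> - p\<close> for \<open>A = (x - 1) y\<close>, \<open>B = y\<close>.
\<close>

lemma sigma1_addition:
  assumes "f_fun p t \<noteq> 0" "f_fun p (x * t) \<noteq> 0" "f_fun p ((x - 1) * t) \<noteq> 0"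
  shows "E1_gen p x t = three_term (sigma1 p) x t + t\<^sup>2 * sigma1 p (x * t)"
proof -
  define y where "y = t / (2 * of_real pi)"
  define P :: complex where "P = of_real p"
  define c where "c = x - 1"
  define e d where "e = exp t" and "d = exp (c * t)"
  have ed: "exp (x * t) = e * d"
    by (simp add: e_def d_def c_def algebra_simps flip: exp_add)
  define f1 f2 f3 where "f1 = f_fun p t" and "f2 = f_fun p (x * t)" and "f3 = f_fun p (c * t)"
  have f: "f1 = (e - 1) * (P + y) + 2 * y"
    "f2 = (e * d - 1) * (P + x * y) + 2 * x * y"
    "f3 = (d - 1) * (P + c * y) + 2 * c * y"
    by (simp_all add: f1_def f2_def f3_def f_fun_def ed P_def y_def flip: e_def d_def)
  have num: "t\<^sup>2 * ((P - x * y) * (P - y) * f3 - (P - c * y) * (P - y) * f2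
      + (P - c * y) * (P - x * y) * f1 + (P - x * y) * f1 * f3)
    = t\<^sup>2 * (2 * x * (1 - x) * y ^ 3 * (e * d))"
    unfolding f c_def by algebra
  have nz: "f1 \<noteq> 0" "f2 \<noteq> 0" "f3 \<noteq> 0"
    using assms by (simp_all add: f1_def f2_def f3_def c_def)
  have "three_term (sigma1 p) x t + t\<^sup>2 * sigma1 p (x * t) =
     t\<^sup>2 * ((P - x * y) / f2 * ((P - y) / f1) - (P - c * y) / f3 * ((P - y) / f1)
      + (P - c * y) / f3 * ((P - x * y) / f2)) + t\<^sup>2 * ((P - x * y) / f2)"
    by (simp add: three_term_def sigma1_def f1_def f2_def f3_def P_def y_def flip: c_def)
  also have "\<dots> = t\<^sup>2 * ((P - x * y) * (P - y) * f3 - (P - c * y) * (P - y) * f2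
      + (P - c * y) * (P - x * y) * f1 + (P - x * y) * f1 * f3) / (f1 * f2 * f3)"
    using nz by (simp add: divide_simps) (simp add: algebra_simps)
  also have "\<dots> = t\<^sup>2 * (2 * x * (1 - x) * y ^ 3 * (e * d)) / (f1 * f2 * f3)"
    by (simp only: num)
  also have "2 * x * (1 - x) * y ^ 3 = x * (1 - x) * (t ^ 3 / (4 * of_real pi ^ 3))"
    by (simp add: y_def power_divide power_mult_distrib)
  also have "t\<^sup>2 * (x * (1 - x) * (t ^ 3 / (4 * of_real pi ^ 3)) * (e * d)) / (f1 * f2 * f3)
      = E1_gen p x t"
  proof -
    have "t\<^sup>2 * t ^ 3 = t ^ 5"
      by (simp flip: power_add)
    then have "t\<^sup>2 * (x * (1 - x) * (t ^ 3 / (4 * of_real pi ^ 3)) * (e * d)) / (f1 * f2 * f3)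
      = x * (1 - x) * t ^ 5 * (e * d) / (4 * of_real pi ^ 3 * f1 * f2 * f3)"
      by (simp add: mult_ac)
    then show ?thesis
      by (simp add: E1_gen_def f1_def f2_def f3_def ed c_def)
  qed
  finally show ?thesis ..
qed

text \<open>
  The zero of \<open>f_fun p\<close> at \<open>0\<close> is simple, since \<open>p + 1 / \<pi> > 0\<close> for \<open>p > 0\<close>; hence
  \<open>t \<sigma>(t)\<close> is regular there.
\<close>

lemma f_fun_fps_expansion:
  obtains G where "f_fun p has_fps_expansion G" "fps_nth G 0 = 0"
    "fps_nth G 1 = of_real (p + 1 / pi)"
proof
  let ?G = "(fps_exp 1 - 1) * (fps_const (of_real p) + fps_X * fps_const (1 / (2 * of_real pi)))
     + fps_X * fps_const (1 / of_real pi) :: complex fps"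
  have "(\<lambda>y. (exp y - 1) * (of_real p + y * (1 / (2 * of_real pi))) + y * (1 / of_real pi))
          has_fps_expansion ?G"
    by (intro fps_expansion_intros)
  then show "f_fun p has_fps_expansion ?G"
    by (simp add: f_fun_def [abs_def])
  show "fps_nth ?G 0 = 0" "fps_nth ?G 1 = of_real (p + 1 / pi)"
    by (simp_all add: fps_mult_nth)
qed

lemma eventually_f_fun_nonzero:
  assumes "p > 0" "c \<noteq> 0"
  shows "\<forall>\<^sub>F t in at 0. f_fun p (c * t) \<noteq> 0"
proof -
  obtain G where G: "f_fun p has_fps_expansion G" "fps_nth G 1 = of_real (p + 1 / pi)"
    by (rule f_fun_fps_expansion)
  have "p + 1 / pi > 0"
    using assms by (simp add: add_pos_pos)
  then have "fps_to_fls G \<noteq> 0"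
    using G(2) by (metis fps_to_fls_eq_0_iff fps_zero_nth of_real_eq_0_iff less_irrefl)
  then have ev: "\<forall>\<^sub>F t in at 0. f_fun p t \<noteq> 0"
    using has_laurent_expansion_nonzero_imp_eventually_nonzero[of "f_fun p" "fps_to_fls G"]
      has_laurent_expansion_fps[OF G(1)] by simp
  have "filterlim (\<lambda>t. c * t) (at 0) (at 0)"
    unfolding filterlim_at using assms by (auto simp: eventually_at_filter intro!: tendsto_eq_intros)
  with ev show ?thesis
    by (rule eventually_compose_filterlim)
qed

lemma egf_first_kind:
  assumes "p > 0"
  obtains f where "f has_fps_expansion egf 1 p" "\<And>t. t \<noteq> 0 \<Longrightarrow> f t = t * sigma1 p t"
proof -
  obtain G where G: "f_fun p has_fps_expansion G" "fps_nth G 0 = 0"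
    "fps_nth G 1 = of_real (p + 1 / pi)"
    by (rule f_fun_fps_expansion)
  have "p + 1 / pi > 0"
    using assms by (simp add: add_pos_pos)
  then have G1: "fps_nth G 1 \<noteq> 0"
    using G(3) by (metis of_real_eq_0_iff less_irrefl)
  then have sub: "subdegree G = 1"
    using G(2) by (intro subdegreeI) auto
  let ?N = "fps_X * (fps_const (of_real p) - fps_X * fps_const (1 / (2 * of_real pi))) :: complex fps"
  have N: "(\<lambda>t. t * (of_real p - t * (1 / (2 * of_real pi)))) has_fps_expansion ?N"
    by (intro fps_expansion_intros)
  have "fps_nth ?N 0 = 0" "fps_nth ?N 1 = of_real p"
    by (simp_all add: fps_mult_nth)
  then have subN: "subdegree ?N = 1"
    using assms by (intro subdegreeI) auto
  (* The limit at the removable singularity 0 of numerator over denominator. *)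
  define c where "c = fps_nth ?N 1 / fps_nth G 1"
  define f where "f = (\<lambda>t. if t = 0 then c else t * (of_real p - t * (1 / (2 * of_real pi))) / f_fun p t)"
  have f: "f has_fps_expansion ?N / G"
    unfolding f_def using sub subN G1 by (intro has_fps_expansion_divide N G) (auto simp: c_def)
  have f_eq: "f t = t * sigma1 p t" if "t \<noteq> 0" for t
    using that by (simp add: f_def sigma1_def)
  let ?g = "\<lambda>t. t / (sigma_frac p (t / (2 * of_real pi)) * exp t - 1)"
  have "\<forall>\<^sub>F t in at 0. t / (2 * of_real pi) \<noteq> complex_of_real p"
  proof -
    have "((\<lambda>t. t / (2 * of_real pi)) \<longlongrightarrow> (0::complex)) (at 0)"
      by (auto intro!: tendsto_eq_intros)
    then show ?thesis
      by (rule tendsto_imp_eventually_ne) (use assms in auto)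
  qed
  moreover have "\<forall>\<^sub>F t in at (0::complex). t \<noteq> 0"
    by (simp add: eventually_at_filter)
  ultimately have "\<forall>\<^sub>F t in at 0. f t = ?g t"
  proof eventually_elim
    case (elim t)
    then have "sigma1 p t = 1 / (sigma_frac p (t / (2 * of_real pi)) * exp t - 1)"
      by (simp only: sigma1_eq not_False_eq_True)
    then show ?case
      using f_eq[of t] elim by simp
  qed
  then have "f has_laurent_expansion fps_to_fls (?N / G) \<longleftrightarrow>
      ?g has_laurent_expansion fps_to_fls (?N / G)"
    by (intro has_laurent_expansion_cong) auto
  then have "laurent_expansion ?g 0 = fps_to_fls (?N / G)"
    using has_laurent_expansion_fps[OF f] by (intro laurent_expansion_0_eqI) simp
  then have "egf 1 p = ?N / G"
    by (simp add: fps_eq_iff egf_def p_bernoulli_def p_bernoulli1_def)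
  then show ?thesis
    using that f f_eq by metis
qed

text \<open>
  By \<open>sigma1_minus\<close> the generating function satisfies \<open>\<phi>(-t) = \<phi>(t) + t\<close>.
\<close>

lemma egf_first_kind_odd:
  assumes "p > 0" "odd n" "n \<noteq> 1"
  shows "fps_nth (egf 1 p) n = 0"
proof -
  let ?F = "egf 1 p"
  obtain f where f: "f has_fps_expansion ?F" "\<And>t. t \<noteq> 0 \<Longrightarrow> f t = t * sigma1 p t"
    by (rule egf_first_kind[OF assms(1)]) (rule that)
  have refl: "(\<lambda>t. f (- t)) has_fps_expansion (?F oo (- fps_X))"
    using has_fps_expansion_compose[OF f(1), of "\<lambda>t. - t" "- fps_X"]
    by (simp add: o_def fps_expansion_intros)
  have sum: "(\<lambda>t. f t + t) has_fps_expansion ?F + fps_X"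
    by (intro fps_expansion_intros f)
  have "\<forall>\<^sub>F t in at 0. f (- t) = f t + t"
    using eventually_f_fun_nonzero[OF assms(1) one_neq_zero] eventually_neq_at_within[of 0 0 UNIV]
  proof eventually_elim
    case (elim t)
    then show ?case
      using f(2)[of t] f(2)[of "- t"] sigma1_minus[of p t] by (simp add: algebra_simps)
  qed
  then have "(\<lambda>t. f (- t)) has_fps_expansion ?F + fps_X"
    using sum has_fps_expansion_cong[of "\<lambda>t. f (- t)" "\<lambda>t. f t + t" "?F + fps_X"]
    by (simp add: eventually_nhds_conv_at)
  then have "?F oo (- fps_X) = ?F + fps_X"
    using refl fps_expansion_unique_complex by blast
  then have "(- 1) ^ n * fps_nth ?F n = fps_nth ?F n + fps_nth fps_X n"
    by (metis fps_add_nth fps_compose_uminus' fps_nth_Abs_fps)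
  then show ?thesis
    using assms by simp
qed

text \<open>
  The generating functions differ by \<open>t\<^sup>2 \<sigma>(x t)\<close>, whose coefficient at \<open>t\<^sup>2\<^sup>k\<close> is a multiple of
  the Bernoulli number with the odd index \<open>2k - 1\<close>. For \<open>k = 1\<close> this number would be the
  nonzero exception.
\<close>

lemma E_coeff_first_kind:
  assumes "p > 0" "k \<ge> 2" "x \<noteq> 0" "x \<noteq> 1"
  shows "P_fun 1 p k x - P_fun 1 p k (x - 1) + x ^ (2 * k - 2) * P_fun 1 p k ((x - 1) / x)
         = E_coeff 1 p k x"
proof -
  obtain f where f: "f has_fps_expansion egf 1 p" "\<And>t. t \<noteq> 0 \<Longrightarrow> f t = t * sigma1 p t"
    by (rule egf_first_kind[OF assms(1)]) (rule that)
  have "k \<ge> 1"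
    using assms by simp
  then obtain H where H: "three_term (\<lambda>t. f t / t) x has_laurent_expansion fps_to_fls H"
    "fps_nth H (2 * k) = P_fun 1 p k x - P_fun 1 p k (x - 1)
       + x ^ (2 * k - 2) * P_fun 1 p k ((x - 1) / x)"
    by (rule three_term_expansion[OF f(1) assms(3,4)]) (rule that)
  let ?R = "fps_const (1 / x) * (fps_X * (egf 1 p oo (fps_const x * fps_X)))"
  have dil: "(\<lambda>t. f (x * t)) has_fps_expansion (egf 1 p oo (fps_const x * fps_X))"
    using has_fps_expansion_compose[OF f(1), of "\<lambda>t. x * t" "fps_const x * fps_X"]
    by (simp add: o_def fps_expansion_intros)
  have "(\<lambda>t. 1 / x * (t * f (x * t))) has_fps_expansion ?R"
    by (intro fps_expansion_intros dil)
  then have R: "(\<lambda>t. 1 / x * (t * f (x * t))) has_laurent_expansion fps_to_fls ?R"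
    by (rule has_laurent_expansion_fps)
  have x1: "x - 1 \<noteq> 0"
    using assms by simp
  have "\<forall>\<^sub>F t in at 0. E_gen 1 p x t = three_term (\<lambda>t. f t / t) x t + 1 / x * (t * f (x * t))"
    using eventually_f_fun_nonzero[OF assms(1) one_neq_zero] eventually_f_fun_nonzero[OF assms(1,3)]
      eventually_f_fun_nonzero[OF assms(1) x1] eventually_neq_at_within[of 0 0 UNIV]
  proof eventually_elim
    case (elim t)
    have "f t / t = sigma1 p t" "f (x * t) / (x * t) = sigma1 p (x * t)"
      "f ((x - 1) * t) / ((x - 1) * t) = sigma1 p ((x - 1) * t)"
      using elim f(2) assms(3) x1 by simp_all
    then have "three_term (\<lambda>t. f t / t) x t = three_term (sigma1 p) x t"
      by (simp add: three_term_def)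
    moreover have "1 / x * (t * f (x * t)) = t\<^sup>2 * sigma1 p (x * t)"
      using f(2)[of "x * t"] elim assms(3) by (simp add: power2_eq_square)
    ultimately show ?case
      using sigma1_addition[of p t x] elim by (simp add: E_gen_def)
  qed
  then have "E_gen 1 p x has_laurent_expansion fps_to_fls H + fps_to_fls ?R \<longleftrightarrow>
     (\<lambda>t. three_term (\<lambda>t. f t / t) x t + 1 / x * (t * f (x * t)))
       has_laurent_expansion fps_to_fls H + fps_to_fls ?R"
    by (intro has_laurent_expansion_cong) auto
  then have "laurent_expansion (E_gen 1 p x) 0 = fps_to_fls H + fps_to_fls ?R"
    using has_laurent_expansion_add[OF H(1) R] by (intro laurent_expansion_0_eqI) simp
  then have "E_coeff 1 p k x = fls_nth (fps_to_fls (H + ?R)) (int (2 * k))"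
    by (simp add: E_coeff_def fps_to_fls_plus)
  also have "\<dots> = fps_nth H (2 * k) + fps_nth ?R (2 * k)"
    by (simp only: fps_to_fls_nth nat_int fps_add_nth) simp
  also have "fps_nth ?R (2 * k) = 0"
    using egf_first_kind_odd[of p "2 * k - 1"] assms by simp
  finally show ?thesis
    using H(2) by simp
qed

section \<open>The positive roots\<close>

definition robin :: "real \<Rightarrow> real \<Rightarrow> real" where
  "robin p x = p * sin (pi * x) + x * cos (pi * x)"

lemma sin_cos_pi_shift:
  "sin (pi * (real j + x)) = (- 1) ^ j * sin (pi * x)"
  "cos (pi * (real j + x)) = (- 1) ^ j * cos (pi * x)"
  by (simp_all add: distrib_left sin_add cos_add mult.commute[of pi "real j"])

text \<open>
  At a zero in the cell, sine and cosine have opposite signs, so the zero lies in the right half,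
  where the cosine keeps its sign. Two zeros \<open>v < w\<close> would give
  \<open>p sin \<pi>(w - v) = (v - w) cos \<pi>v cos \<pi>w < 0\<close>, but \<open>0 < w - v < 1\<close>.
\<close>

lemma robin_cell_unique:
  assumes p: "p > 0" and x: "real j < x" "x < real j + 1" and y: "real j < y" "y < real j + 1"
    and rx: "robin p x = 0" and ry: "robin p y = 0"
  shows "x = y"
proof -
  have half: "cos (pi * (z - real j)) < 0"
    if z: "real j < z" "z < real j + 1" and r: "robin p z = 0" for z
  proof (rule ccontr)
    assume "\<not> cos (pi * (z - real j)) < 0"
    moreover have "sin (pi * (z - real j)) > 0"
      using z by (intro sin_gt_zero) auto
    ultimately have "p * sin (pi * (z - real j)) + z * cos (pi * (z - real j)) > 0"
      using p z by (intro add_pos_nonneg mult_pos_pos mult_nonneg_nonneg) auto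
    moreover have "robin p z = (- 1) ^ j * (p * sin (pi * (z - real j)) + z * cos (pi * (z - real j)))"
      using sin_cos_pi_shift[of j "z - real j"] by (simp add: robin_def algebra_simps)
    ultimately show False
      using r by simp
  qed
  have less_False: False
    if v: "real j < v" "v < w" "w < real j + 1" and r: "robin p v = 0" "robin p w = 0" for v w
  proof -
    let ?cv = "cos (pi * (v - real j))" and ?cw = "cos (pi * (w - real j))"
    let ?sv = "sin (pi * (v - real j))" and ?sw = "sin (pi * (w - real j))"
    have zero: "p * ?sv + v * ?cv = 0" "p * ?sw + w * ?cw = 0"
      using sin_cos_pi_shift[of j "v - real j"] sin_cos_pi_shift[of j "w - real j"] r
      by (simp_all add: robin_def algebra_simps minus_one_power_iff split: if_splits)
    have "pi * (w - v) = pi * (w - real j) - pi * (v - real j)"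
      by (simp add: algebra_simps)
    then have "sin (pi * (w - v)) = ?sw * ?cv - ?cw * ?sv"
      by (simp only: sin_diff)
    then have "p * sin (pi * (w - v)) = (v - w) * (?cv * ?cw)"
      using zero by algebra
    moreover have "sin (pi * (w - v)) > 0"
      using v by (intro sin_gt_zero) auto
    moreover have "?cv * ?cw > 0"
      using half[of v] half[of w] v r by (intro mult_neg_neg) auto
    ultimately show False
      using p v by (metis diff_less_0_iff_less less_asym mult_neg_pos mult_pos_pos)
  qed
  show ?thesis
    using less_False[of x y] less_False[of y x] assms by fastforce
qed

text \<open>
  The sign changes between the midpoint \<open>j + 1/2\<close> and the right end of the cell. The left end
  will not do, because the function vanishes at \<open>0\<close>.
\<close>

lemma robin_cell_exists:
  assumes "p > 0"
  shows "\<exists>x. real j < x \<and> x < real j + 1 \<and> robin p x = 0"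
proof -
  let ?r = "\<lambda>x. (- 1) ^ j * robin p x"
  have sq: "(- 1) ^ j * (c * (- 1) ^ j) = c" for c :: real
    by (simp add: mult.left_commute flip: power_mult_distrib)
  have "?r (real j + 1 / 2) = p"
    using sin_cos_pi_shift[of j "1 / 2"] sq by (simp add: robin_def)
  moreover have "?r (real j + 1) = - (real j + 1)"
    using sin_cos_pi_shift[of j 1] by (simp add: robin_def sq)
  moreover have "continuous_on {real j + 1 / 2..real j + 1} (\<lambda>x. - ?r x)"
    unfolding robin_def by (intro continuous_intros)
  ultimately obtain x where "real j + 1 / 2 \<le> x" "x \<le> real j + 1" "- ?r x = 0"
    using IVT'[of "\<lambda>x. - ?r x" "real j + 1 / 2" 0 "real j + 1"] assms by auto
  moreover from this have "x \<noteq> real j + 1"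
    using \<open>?r (real j + 1) = - (real j + 1)\<close> by auto
  ultimately show ?thesis
    by (intro exI[of _ x]) auto
qed

lemma robin_of_nat: "robin p (real n) = (- 1) ^ n * real n"
  using sin_cos_pi_shift[of n 0] by (simp add: robin_def)

lemma strict_mono_range_unique:
  fixes f g :: "nat \<Rightarrow> 'a::linorder"
  assumes "strict_mono f" "strict_mono g" "range f = range g"
  shows "f = g"
proof
  fix n
  show "f n = g n"
  proof (induction n rule: less_induct)
    case (less n)
    have le: "f' n \<le> g' n"
      if f': "strict_mono f'" and g': "strict_mono g'" and "range f' = range g'"
        and below: "\<And>m. m < n \<Longrightarrow> f' m = g' m"
      for f' g' :: "nat \<Rightarrow> 'a"
    proof -
      obtain m where m: "g' n = f' m"
        using \<open>range f' = range g'\<close> by (metis rangeE rangeI)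
      have "\<not> m < n"
      proof
        assume "m < n"
        then have "g' m < g' n" "f' m = g' m"
          using g' below by (auto dest: strict_monoD)
        then show False
          using m by simp
      qed
      then show ?thesis
        using f' m by (simp add: strict_mono_less_eq)
    qed
    show ?case
    proof (rule order_antisym)
      show "f n \<le> g n"
        using assms less by (intro le) auto
      show "g n \<le> f n"
        using assms less by (intro le) auto
    qed
  qed
qed

text \<open>
  One root in each open cell and none at the positive integers yields an increasing enumeration,
  and \<open>pos_root\<close> is the only one.
\<close>

lemma pos_root_cell:
  assumes "p > 0"
  shows "real j < pos_root p j" "pos_root p j < real j + 1" "robin p (pos_root p j) = 0"
    and range_pos_root: "range (pos_root p) = {x. x > 0 \<and> robin p x = 0}"
proof -
  define lam where "lam j = (SOME x. real j < x \<and> x < real j + 1 \<and> robin p x = 0)" for j :: nat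
  have lam: "real j < lam j \<and> lam j < real j + 1 \<and> robin p (lam j) = 0" for j
    unfolding lam_def by (rule someI_ex) (rule robin_cell_exists[OF assms])
  have mono: "strict_mono lam"
    unfolding strict_mono_Suc_iff
  proof
    fix j
    show "lam j < lam (Suc j)"
      using lam[of j] lam[of "Suc j"] by simp
  qed
  have range: "range lam = {x. x > 0 \<and> robin p x = 0}"
  proof (intro equalityI subsetI)
    fix x assume "x \<in> range lam"
    then show "x \<in> {x. x > 0 \<and> robin p x = 0}"
      using lam by (auto intro: le_less_trans[OF of_nat_0_le_iff])
  next
    fix x assume x: "x \<in> {x. x > 0 \<and> robin p x = 0}"
    define j where "j = nat \<lfloor>x\<rfloor>"
    have j: "real j \<le> x" "x < real j + 1"
      using x by (auto simp: j_def)
    have "real j \<noteq> x"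
      using x robin_of_nat[of p j] by auto
    with j have "real j < x"
      by linarith
    moreover have "robin p x = 0"
      using x by simp
    ultimately have "lam j = x"
      using robin_cell_unique[OF assms, of j "lam j" x] lam[of j] j by blast
    then show "x \<in> range lam"
      by (metis rangeI)
  qed
  have "pos_root p = lam"
    unfolding pos_root_def
  proof (rule the_equality)
    show "strict_mono lam \<and> range lam = {x. x > 0 \<and> p * sin (pi * x) + x * cos (pi * x) = 0}"
      using mono range by (simp add: robin_def)
    show "f = lam" if "strict_mono f \<and>
        range f = {x. x > 0 \<and> p * sin (pi * x) + x * cos (pi * x) = 0}" for f
      using that mono range by (intro strict_mono_range_unique) (simp_all add: robin_def)
  qed
  then show "real j < pos_root p j" "pos_root p j < real j + 1" "robin p (pos_root p j) = 0"
    "range (pos_root p) = {x. x > 0 \<and> robin p x = 0}"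
    using lam range by simp_all
qed

section \<open>The quotient of the Robin functions off the real axis\<close>

definition crobin :: "real \<Rightarrow> complex \<Rightarrow> complex" where
  "crobin p s = of_real p * sin (of_real pi * s) + s * cos (of_real pi * s)"

text \<open>
  At a root, \<open>\<pi>\<close> times the quotient of this function by the derivative of \<open>crobin p\<close> is the weight
  in \<open>sigma_p\<close>.
\<close>

definition drobin :: "real \<Rightarrow> complex \<Rightarrow> complex" where
  "drobin p s = of_real p * cos (of_real pi * s) - s * sin (of_real pi * s)"

text \<open>
  The two exponential parts of \<open>g = crobin p\<close> and \<open>h = drobin p\<close>:
  \<open>h + \<i> g\<close> decays and \<open>h - \<i> g\<close> grows towards \<open>+ \<i> \<infinity>\<close>.
\<close>

definition incoming :: "real \<Rightarrow> complex \<Rightarrow> complex" where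
  "incoming p s = (of_real p + \<i> * s) * exp (\<i> * (of_real pi * s))"

definition outgoing :: "real \<Rightarrow> complex \<Rightarrow> complex" where
  "outgoing p s = (of_real p - \<i> * s) * exp (- (\<i> * (of_real pi * s)))"

definition remainder :: "real \<Rightarrow> complex \<Rightarrow> complex" where
  "remainder p s = incoming p s / crobin p s"

lemma incoming_eq: "drobin p s + \<i> * crobin p s = incoming p s"
proof -
  have "exp (\<i> * (of_real pi * s)) = cos (of_real pi * s) + \<i> * sin (of_real pi * s)"
    by (rule exp_Euler)
  then show ?thesis
    unfolding incoming_def drobin_def crobin_def by (simp only:) (simp add: algebra_simps)
qed

lemma outgoing_eq: "drobin p s - \<i> * crobin p s = outgoing p s"
proof -
  have "exp (- (\<i> * (of_real pi * s))) = cos (of_real pi * s) - \<i> * sin (of_real pi * s)"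
    by (rule exp_minus_Euler)
  then show ?thesis
    unfolding outgoing_def drobin_def crobin_def by (simp only:) (simp add: algebra_simps)
qed

lemma crobin_eq: "2 * \<i> * crobin p s = incoming p s - outgoing p s"
  by (simp flip: incoming_eq outgoing_eq)

text \<open>
  In the upper half-plane \<open>- \<i>\<close> is the limit of the quotient, and the remainder decays
  exponentially.
\<close>

lemma drobin_over_crobin:
  assumes "crobin p s \<noteq> 0"
  shows "drobin p s / crobin p s = - \<i> + remainder p s"
  using assms by (simp add: remainder_def flip: incoming_eq) (simp add: field_simps)

lemma crobin_of_real: "crobin p (of_real x) = of_real (robin p x)"
  by (simp add: crobin_def robin_def sin_of_real cos_of_real flip: of_real_mult)

lemma crobin_cnj: "crobin p (cnj s) = cnj (crobin p s)"
  by (simp add: crobin_def cnj_sin cnj_cos)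

lemma drobin_cnj: "drobin p (cnj s) = cnj (drobin p s)"
  by (simp add: drobin_def cnj_sin cnj_cos)

lemma outgoing_nonzero:
  assumes "p > 0" "Im s \<ge> 0"
  shows "outgoing p s \<noteq> 0"
proof -
  have "Re (of_real p - \<i> * s) > 0"
    using assms by simp
  then have "of_real p - \<i> * s \<noteq> 0"
    by force
  then show ?thesis
    by (simp add: outgoing_def)
qed

lemma norm_incoming_le:
  assumes "p > 0" "Im s \<ge> 0"
  shows "norm (incoming p s) \<le> exp (- 2 * pi * Im s) * norm (outgoing p s)"
proof -
  have "(norm (of_real p + \<i> * s))\<^sup>2 \<le> (norm (of_real p - \<i> * s))\<^sup>2"
    using mult_nonneg_nonneg[of p "Im s"] assms
    unfolding cmod_power2 by (simp add: power2_eq_square algebra_simps)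
  then have "norm (of_real p + \<i> * s) \<le> norm (of_real p - \<i> * s)"
    by (rule power2_le_imp_le) simp
  moreover have "exp (- (pi * Im s)) = exp (- 2 * pi * Im s) * exp (pi * Im s)"
    by (simp flip: exp_add)
  ultimately show ?thesis
    by (simp add: incoming_def outgoing_def norm_mult)
qed

text \<open>
  At a zero the two exponential parts agree, but in the open upper half-plane they have different
  size. The lower half-plane follows by conjugation.
\<close>

lemma crobin_zero_imp_real:
  assumes p: "p > 0" and zero: "crobin p s = 0"
  shows "Im s = 0"
proof -
  have no_upper_zero: False if "Im z > 0" "crobin p z = 0" for z
  proof -
    have eq: "incoming p z = outgoing p z"
      using crobin_eq[of p z] that by simp
    have "norm (outgoing p z) \<le> exp (- 2 * pi * Im z) * norm (outgoing p z)"
      using norm_incoming_le[of p z] p that eq by simp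
    moreover have "exp (- 2 * pi * Im z) < 1"
      using that by simp
    moreover have "norm (outgoing p z) > 0"
      using outgoing_nonzero[of p z] p that by simp
    ultimately show False
      using mult_less_cancel_right2[of "exp (- 2 * pi * Im z)" "norm (outgoing p z)"] by simp
  qed
  show ?thesis
    using no_upper_zero[of s] no_upper_zero[of "cnj s"] zero crobin_cnj[of p s]
    by (cases "Im s" "0::real" rule: linorder_cases) auto
qed

text \<open>
  Two complex numbers at an obtuse or right angle have a difference at least as large as either of
  them. This gives a bound that does not degenerate near the real axis, where both exponential
  parts have nearly the same size.
\<close>

lemma remainder_bound_Re_le_0:
  assumes p: "p > 0" and y: "Im s \<ge> 0" and Re: "Re (incoming p s * cnj (outgoing p s)) \<le> 0"
  shows "crobin p s \<noteq> 0" "norm (remainder p s) \<le> 4 * exp (- 2 * pi * Im s)"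
proof -
  let ?A = "incoming p s" and ?B = "outgoing p s"
  have "(norm (?A - ?B))\<^sup>2 = (norm ?A)\<^sup>2 + (norm ?B)\<^sup>2 - 2 * Re (?A * cnj ?B)"
    unfolding cmod_power2 by (simp add: power2_eq_square algebra_simps)
  then have "(norm ?B)\<^sup>2 \<le> (norm (?A - ?B))\<^sup>2"
    using Re by simp
  then have AB: "norm ?B \<le> norm (?A - ?B)"
    by (rule power2_le_imp_le) simp
  have B: "norm ?B > 0"
    using outgoing_nonzero[of p s] p y by simp
  have g: "norm (crobin p s) = norm (?A - ?B) / 2"
    by (simp add: norm_mult flip: crobin_eq)
  show "crobin p s \<noteq> 0"
    using g AB B by auto
  have "norm (remainder p s) = 2 * norm ?A / norm (?A - ?B)"
    by (simp add: remainder_def norm_divide g)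
  also have "\<dots> \<le> 2 * (exp (- 2 * pi * Im s) * norm ?B) / norm ?B"
    using AB B norm_incoming_le[of p s] p y by (intro frac_le) auto
  also have "\<dots> = 2 * exp (- 2 * pi * Im s)"
    using B by simp
  finally show "norm (remainder p s) \<le> 4 * exp (- 2 * pi * Im s)"
    using exp_ge_zero[of "- 2 * pi * Im s"] by linarith
qed

lemma incoming_cnj_outgoing:
  "incoming p s * cnj (outgoing p s) =
     (of_real (p\<^sup>2 - (Re s)\<^sup>2 - (Im s)\<^sup>2) + 2 * \<i> * of_real (p * Re s)) * cis (2 * pi * Re s)"
proof -
  have "cnj (outgoing p s) = (of_real p + \<i> * cnj s) * exp (\<i> * (of_real pi * cnj s))"
    by (simp add: outgoing_def exp_cnj)
  moreover have "exp (\<i> * (of_real pi * s)) * exp (\<i> * (of_real pi * cnj s)) = cis (2 * pi * Re s)"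
  proof -
    have "\<i> * (of_real pi * s) + \<i> * (of_real pi * cnj s) = \<i> * of_real (2 * pi * Re s)"
      by (simp add: complex_eq_iff)
    then show ?thesis
      by (simp only: cis_conv_exp flip: exp_add)
  qed
  moreover have "(of_real p + \<i> * s) * (of_real p + \<i> * cnj s) =
      of_real (p\<^sup>2 - (Re s)\<^sup>2 - (Im s)\<^sup>2) + 2 * \<i> * of_real (p * Re s)"
    by (simp add: complex_eq_iff power2_eq_square algebra_simps)
  ultimately show ?thesis
    by (simp add: incoming_def mult_ac)
qed

text \<open>
  The abscissa \<open>1/4\<close> is left of all roots for every \<open>p\<close>, and there \<open>e\<^sup>2\<^sup>\<pi>\<^sup>\<i>\<^sup>x = \<i>\<close> makes the sign
  condition independent of the size of \<open>p\<close>.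
\<close>

lemma remainder_bound_quarter:
  assumes "p > 0" "Re s = 1 / 4" "Im s \<ge> 0"
  shows "crobin p s \<noteq> 0" "norm (remainder p s) \<le> 4 * exp (- 2 * pi * Im s)"
proof -
  have "2 * pi * Re s = pi / 2"
    using assms by simp
  then have "cis (2 * pi * Re s) = \<i>"
    by (simp only: cis_pi_half)
  then have "incoming p s * cnj (outgoing p s) =
      (of_real (p\<^sup>2 - (Re s)\<^sup>2 - (Im s)\<^sup>2) + 2 * \<i> * of_real (p * Re s)) * \<i>"
    by (simp only: incoming_cnj_outgoing)
  then have "Re (incoming p s * cnj (outgoing p s)) \<le> 0"
    using assms by simp
  then show "crobin p s \<noteq> 0" "norm (remainder p s) \<le> 4 * exp (- 2 * pi * Im s)"
    using remainder_bound_Re_le_0[of p s] assms by simp_all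
qed

text \<open>
  At integral abscissas \<open>e\<^sup>2\<^sup>\<pi>\<^sup>\<i>\<^sup>x = 1\<close>, and \<open>N \<ge> p\<close> suffices for the sign condition.
\<close>

lemma remainder_bound_nat:
  assumes "p > 0" "Re s = real N" "real N \<ge> p" "Im s \<ge> 0"
  shows "crobin p s \<noteq> 0" "norm (remainder p s) \<le> 4 * exp (- 2 * pi * Im s)"
proof -
  have "cis (2 * pi * real N) = 1"
    by (simp add: complex_eq_iff)
  moreover have "p\<^sup>2 \<le> (real N)\<^sup>2 + (Im s)\<^sup>2"
    using assms by (intro add_increasing2 power_mono) auto
  ultimately have "Re (incoming p s * cnj (outgoing p s)) \<le> 0"
    using assms by (simp add: incoming_cnj_outgoing)
  then show "crobin p s \<noteq> 0" "norm (remainder p s) \<le> 4 * exp (- 2 * pi * Im s)"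
    using remainder_bound_Re_le_0[of p s] assms by simp_all
qed

text \<open>
  Away from the real axis the dominating part is at least twice as large as the other one, which
  bounds their difference from below.
\<close>

lemma remainder_bound_upper:
  assumes p: "p > 0" and y: "Im s \<ge> 1"
  shows "crobin p s \<noteq> 0" "norm (remainder p s) \<le> 4 * exp (- 2 * pi * Im s)"
proof -
  show nz: "crobin p s \<noteq> 0"
    using crobin_zero_imp_real[of p s] assms by auto
  let ?A = "incoming p s" and ?B = "outgoing p s"
  have B: "norm ?B > 0"
    using outgoing_nonzero[of p s] assms by simp
  have "2 \<le> 1 + 2 * pi * Im s"
  proof -
    have "1 \<le> 2 * pi * 1"
      using pi_gt3 by simp
    also have "\<dots> \<le> 2 * pi * Im s"
      using y by (intro mult_left_mono) auto
    finally show ?thesis by simp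
  qed
  also have "\<dots> \<le> exp (2 * pi * Im s)"
    by (rule exp_ge_add_one_self)
  finally have "exp (- 2 * pi * Im s) \<le> 1 / 2"
    by (simp add: exp_minus inverse_eq_divide field_simps)
  then have "norm ?A \<le> 1 / 2 * norm ?B"
    using norm_incoming_le[of p s] assms by (smt (verit) mult_right_mono norm_ge_zero)
  then have AB: "norm ?B / 2 \<le> norm (?A - ?B)"
    using norm_triangle_ineq3[of ?B ?A] by (simp add: norm_minus_commute)
  have g: "norm (crobin p s) = norm (?A - ?B) / 2"
    by (simp add: norm_mult flip: crobin_eq)
  have "norm (remainder p s) = 2 * norm ?A / norm (?A - ?B)"
    by (simp add: remainder_def norm_divide g)
  also have "\<dots> \<le> 2 * (exp (- 2 * pi * Im s) * norm ?B) / (norm ?B / 2)"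
    using AB B norm_incoming_le[of p s] assms by (intro frac_le) auto
  also have "\<dots> = 4 * exp (- 2 * pi * Im s)"
    using B by simp
  finally show "norm (remainder p s) \<le> 4 * exp (- 2 * pi * Im s)" .
qed

section \<open>Partial sums as contour integrals\<close>

definition weight :: "real \<Rightarrow> real \<Rightarrow> real" where
  "weight p x = (p\<^sup>2 + x\<^sup>2) / (p * (p + 1 / pi) + x\<^sup>2)"

definition robin_kernel :: "real \<Rightarrow> complex \<Rightarrow> complex \<Rightarrow> complex" where
  "robin_kernel p t s = drobin p s * exp (- (s * t)) / crobin p s"

lemma crobin_holomorphic: "crobin p holomorphic_on A"
  unfolding crobin_def [abs_def] by (intro holomorphic_intros)

lemma drobin_holomorphic: "drobin p holomorphic_on A"
  unfolding drobin_def [abs_def] by (intro holomorphic_intros)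

lemma kernel_holomorphic:
  assumes "\<And>s. s \<in> A \<Longrightarrow> crobin p s \<noteq> 0"
  shows "robin_kernel p t holomorphic_on A"
  unfolding robin_kernel_def [abs_def] using assms
  by (intro holomorphic_intros drobin_holomorphic crobin_holomorphic) auto

text \<open>
  With \<open>sin \<pi>x = - (x / p) cos \<pi>x\<close> at a root \<open>x\<close>, both the numerator \<open>h(x)\<close> and the derivative
  \<open>g'(x)\<close> become multiples of \<open>cos \<pi>x\<close>, and their quotient is the weight in \<open>sigma_p\<close> up to
  \<open>\<pi>\<close>.
\<close>

lemma residue_kernel:
  assumes p: "p > 0" and zero: "robin p x = 0"
  shows "residue (robin_kernel p t) (of_real x) = of_real (weight p x / pi) * exp (- (of_real x * t))"
proof -
  let ?c = "cos (pi * x)" and ?s = "sin (pi * x)"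
  have sin: "?s = - x * ?c / p"
    using zero p by (simp add: robin_def field_simps)
  have c: "?c \<noteq> 0"
    using sin sin_cos_squared_add[of "pi * x"] by auto
  define d where "d = p * pi * ?c + ?c - x * pi * ?s"
  have pos: "p * (p + 1 / pi) + x\<^sup>2 > 0"
    using p by (intro add_pos_nonneg mult_pos_pos add_pos_pos) auto
  have d: "d = pi * ?c / p * (p * (p + 1 / pi) + x\<^sup>2)"
    unfolding d_def sin using p by (simp add: field_simps power2_eq_square)
  have h: "p * ?c - x * ?s = ?c / p * (p\<^sup>2 + x\<^sup>2)"
    unfolding sin using p by (simp add: field_simps power2_eq_square)
  have d0: "d \<noteq> 0"
    unfolding d using c p pos by simp
  have h0: "p * ?c - x * ?s \<noteq> 0"
    unfolding h using c p by (simp add: sum_power2_eq_zero_iff)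
  (* Both d and the numerator carry the factor ?c / p, which cancels. *)
  have quotient: "(p * ?c - x * ?s) / d = weight p x / pi"
    unfolding d h weight_def using c p by simp
  have trig: "sin (of_real pi * of_real x) = complex_of_real ?s"
    "cos (of_real pi * of_real x) = complex_of_real ?c"
    by (simp_all add: sin_of_real cos_of_real flip: of_real_mult)
  have drobin: "drobin p (of_real x) = of_real (p * ?c - x * ?s)"
    by (simp add: drobin_def trig)
  have deriv: "(crobin p has_field_derivative of_real d) (at (of_real x))"
    unfolding crobin_def [abs_def] d_def
    by (rule derivative_eq_intros refl)+ (simp add: trig algebra_simps)
  have "residue (\<lambda>s. drobin p s * exp (- (s * t)) / crobin p s) (of_real x) =
      drobin p (of_real x) * exp (- (of_real x * t)) / of_real d"
  proof (rule residue_simple_pole_deriv[where s = UNIV])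
    show "(\<lambda>s. drobin p s * exp (- (s * t))) holomorphic_on UNIV"
      by (intro holomorphic_intros drobin_holomorphic)
    show "drobin p (of_real x) * exp (- (of_real x * t)) \<noteq> 0"
      using h0 by (simp only: drobin) (simp add: of_real_eq_0_iff del: of_real_diff of_real_mult)
    show "crobin p (of_real x) = 0"
      by (simp add: crobin_of_real zero)
  qed (use deriv d0 in \<open>auto intro: crobin_holomorphic\<close>)
  also have "\<dots> = of_real ((p * ?c - x * ?s) / d) * exp (- (of_real x * t))"
    by (simp add: drobin)
  finally show ?thesis
    by (simp only: quotient robin_kernel_def [abs_def])
qed

text \<open>
  No root lies to the left of \<open>1/2\<close>, so the rectangles with left side at \<open>1/4\<close> contain the first root.
\<close>

lemma robin_pos_left:
  assumes "p > 0" "0 < x" "x \<le> 1 / 2"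
  shows "robin p x > 0"
proof -
  have "pi * x \<le> pi * (1 / 2)"
    using assms by (intro mult_left_mono) auto
  moreover have "pi * x > 0"
    using assms by simp
  ultimately have "sin (pi * x) > 0" "cos (pi * x) \<ge> 0"
    using pi_gt_zero by (auto intro!: sin_gt_zero cos_ge_zero simp del: pi_gt_zero)
  then show ?thesis
    using assms unfolding robin_def by (intro add_pos_nonneg mult_pos_pos mult_nonneg_nonneg) auto
qed

lemma crobin_nonzero:
  assumes p: "p > 0" and "Re s = 1 / 4 \<or> (\<exists>N. Re s = real N \<and> real N \<ge> p) \<or> Im s \<noteq> 0"
  shows "crobin p s \<noteq> 0"
proof -
  have "Im s = 0 \<Longrightarrow> crobin p s \<noteq> 0"
    using remainder_bound_quarter(1)[of p s] remainder_bound_nat(1)[of p s] assms by auto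
  then show ?thesis
    using crobin_zero_imp_real[of p s] p by auto
qed

text \<open>
  The right side \<open>Re s = N\<close> separates the roots with index below \<open>N\<close> from the others. The strip
  in which the residue theorem is applied also contains the root with index \<open>N\<close>, which has winding
  number \<open>0\<close>.
\<close>

lemma contour_integral_kernel_rectpath:
  assumes p: "p > 0" and N: "real N \<ge> p" "N \<ge> 1"
  shows "contour_integral (rectpath (Complex (1/4) (- real N)) (Complex (real N) (real N))) (robin_kernel p t)
     = 2 * \<i> * (\<Sum>j<N. of_real (weight p (pos_root p j)) * exp (- (of_real (pos_root p j) * t)))"
proof -
  let ?a = "Complex (1/4) (- real N)" and ?b = "Complex (real N) (real N)"
  let ?S = "{s. 0 < Re s \<and> Re s < real N + 1}"
  let ?root = "\<lambda>j. complex_of_real (pos_root p j)"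
  let ?pts = "?root ` {..N}"
  note cell = pos_root_cell[OF p]
  have inj: "inj_on ?root {..N}"
  proof (rule inj_onI)
    fix i j assume "?root i = ?root j"
    then show "i = j"
      using cell(1,2)[of i] cell(1,2)[of j] by simp
  qed
  have nz: "crobin p s \<noteq> 0" if s: "s \<in> ?S - ?pts" for s
  proof
    assume zero: "crobin p s = 0"
    then have "Im s = 0"
      using crobin_zero_imp_real p by blast
    then have s_eq: "s = of_real (Re s)"
      by (simp add: complex_eq_iff)
    then have "robin p (Re s) = 0"
      using zero crobin_of_real[of p "Re s"] by simp
    then obtain j where j: "Re s = pos_root p j"
      using s cell(4) by auto
    then have "j \<le> N"
      using s cell(1)[of j] by simp
    moreover have "s = ?root j"
      using s_eq unfolding j .
    ultimately have "s \<in> ?pts"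
      by simp
    then show False
      using s by blast
  qed
  have "convex ?S"
  proof -
    have "?S = {s. 0 < Re s} \<inter> {s. Re s < real N + 1}"
      by auto
    then show ?thesis
      by (simp add: convex_Int convex_halfspace_Re_gt convex_halfspace_Re_lt)
  qed
  have "open ?S"
    by (intro open_Collect_conj open_Collect_less continuous_intros)
  have sub: "cbox ?a ?b \<subseteq> ?S"
    by (auto simp: in_cbox_complex_iff)
  have rect: "path_image (rectpath ?a ?b) \<subseteq> cbox ?a ?b"
    by (rule path_image_rectpath_subset_cbox) (use N in auto)
  have "contour_integral (rectpath ?a ?b) (robin_kernel p t) =
      2 * pi * \<i> * (\<Sum>s\<in>?pts. winding_number (rectpath ?a ?b) s * residue (robin_kernel p t) s)"
  proof (rule Residue_theorem[where S = ?S])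
    show "path_image (rectpath ?a ?b) \<subseteq> ?S - ?pts"
    proof -
      have "s \<notin> ?pts" if "s \<in> path_image (rectpath ?a ?b)" for s
      proof
        assume "s \<in> ?pts"
        then have "crobin p s = 0"
          by (auto simp: crobin_of_real cell(3))
        moreover have "Re s = 1 / 4 \<or> Re s = real N \<or> Im s \<noteq> 0"
          using that N by (subst (asm) path_image_rectpath) auto
        ultimately show False
          using crobin_nonzero[OF p, of s] N by blast
      qed
      then show ?thesis
        using rect sub by blast
    qed
    show "\<forall>z. z \<notin> ?S \<longrightarrow> winding_number (rectpath ?a ?b) z = 0"
      using sub N by (intro allI impI winding_number_rectpath_outside) auto
  qed (use \<open>open ?S\<close> \<open>convex ?S\<close> nz in \<open>auto intro!: kernel_holomorphic convex_connected\<close>)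
  also have "(\<Sum>s\<in>?pts. winding_number (rectpath ?a ?b) s * residue (robin_kernel p t) s) =
      (\<Sum>j\<le>N. winding_number (rectpath ?a ?b) (?root j) * residue (robin_kernel p t) (?root j))"
    using inj by (simp add: sum.reindex)
  also have "\<dots> = (\<Sum>j<N. residue (robin_kernel p t) (?root j))"
  proof -
    have outside: "winding_number (rectpath ?a ?b) (?root N) = 0"
      using cell(1)[of N] N by (intro winding_number_rectpath_outside) (auto simp: in_cbox_complex_iff)
    have inside: "winding_number (rectpath ?a ?b) (?root j) = 1" if "j < N" for j
    proof -
      have "pos_root p j > 1 / 2"
        using robin_pos_left[OF p, of "pos_root p j"] cell(1,3)[of j] by force
      moreover have "real j + 1 \<le> real N"
        using that by simp
      ultimately show ?thesis
        using cell(2)[of j] N by (intro winding_number_rectpath) (auto simp: in_box_complex_iff)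
    qed
    show ?thesis
      by (simp add: inside outside flip: lessThan_Suc_atMost)
  qed
  finally show ?thesis
    by (simp add: residue_kernel[OF p cell(3)] sum_distrib_left mult_ac)
qed

section \<open>Reduction to the upper half-plane\<close>

definition damped :: "real \<Rightarrow> complex \<Rightarrow> complex \<Rightarrow> complex" where
  "damped p t s = remainder p s * exp (- (s * t))"

text \<open>
  The part of the boundary of the rectangle above the real axis, run counterclockwise.
\<close>

definition upper_contour :: "real \<Rightarrow> complex \<Rightarrow> nat \<Rightarrow> complex" where
  "upper_contour p t N =
     contour_integral (linepath (of_nat N) (Complex (real N) (real N))) (robin_kernel p t)
   + contour_integral (linepath (Complex (real N) (real N)) (Complex (1/4) (real N))) (robin_kernel p t)
   + contour_integral (linepath (Complex (1/4) (real N)) (1/4)) (robin_kernel p t)"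

lemma kernel_cnj: "robin_kernel p (cnj t) (cnj s) = cnj (robin_kernel p t s)"
  by (simp add: robin_kernel_def crobin_cnj drobin_cnj exp_cnj)

lemma contour_integral_kernel_cnj:
  "contour_integral (linepath (cnj a) (cnj b)) (robin_kernel p (of_real t)) =
   cnj (contour_integral (linepath a b) (robin_kernel p (of_real t)))"
proof -
  have "cnj \<circ> linepath a b = linepath (cnj a) (cnj b)"
    by (simp add: linepath_def fun_eq_iff)
  moreover have "cnj \<circ> robin_kernel p (of_real t) \<circ> cnj = robin_kernel p (of_real t)"
    using kernel_cnj[of p "of_real t"] by (simp add: fun_eq_iff)
  ultimately show ?thesis
    using contour_integral_cnj[of "linepath a b" "robin_kernel p (of_real t)"] by simp
qed

text \<open>
  For real \<open>t\<close> the integrand commutes with conjugation, so the lower half of the boundary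
  contributes minus the conjugate of the upper half. Thus estimates are only needed in the upper
  half-plane.
\<close>

lemma contour_integral_kernel_fold:
  assumes p: "p > 0" and N: "real N \<ge> p" "N \<ge> 1"
  shows "contour_integral (rectpath (Complex (1/4) (- real N)) (Complex (real N) (real N)))
      (robin_kernel p (of_real t)) = 2 * \<i> * of_real (Im (upper_contour p (of_real t) N))"
proof -
  let ?K = "robin_kernel p (of_real t)"
  define a where "a = Complex (1/4) (real N)"
  define b where "b = Complex (real N) (real N)"
  define a0 b0 :: complex where "a0 = 1/4" and "b0 = of_nat N"
  have real_pts: "cnj a0 = a0" "cnj b0 = b0"
    by (simp_all add: a0_def b0_def)
  have nz: "crobin p s \<noteq> 0"
    if "s \<in> closed_segment a (cnj a) \<or> s \<in> closed_segment b (cnj b)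
        \<or> s \<in> closed_segment (cnj a) (cnj b) \<or> s \<in> closed_segment a b" for s
  proof (rule crobin_nonzero[OF p])
    show "Re s = 1 / 4 \<or> (\<exists>M. Re s = real M \<and> p \<le> real M) \<or> Im s \<noteq> 0"
      using that N by (auto simp: a_def b_def closed_segment_same_Re closed_segment_same_Im)
  qed
  have cont: "continuous_on (closed_segment a (cnj a)) ?K" "continuous_on (closed_segment b (cnj b)) ?K"
    "continuous_on (closed_segment (cnj b) b) ?K"
    "continuous_on (closed_segment (cnj a) (cnj b)) ?K" "continuous_on (closed_segment a b) ?K"
    "continuous_on (closed_segment b a) ?K"
    using nz by (auto intro!: holomorphic_on_imp_continuous_on kernel_holomorphic
        simp: closed_segment_commute)
  have mid: "a0 \<in> closed_segment a (cnj a)" "b0 \<in> closed_segment (cnj b) b"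
    by (auto simp: a_def b_def a0_def b0_def closed_segment_same_Re closed_segment_eq_real_ivl)
  have sub: "closed_segment b b0 \<subseteq> closed_segment (cnj b) b" "closed_segment a a0 \<subseteq> closed_segment a (cnj a)"
    using mid by (simp_all add: subset_closed_segment)
  have corners: "Complex (Re b) (Im (cnj a)) = cnj b" "Complex (Re (cnj a)) (Im b) = a"
    by (simp_all add: a_def b_def complex_eq_iff)
  have "contour_integral (rectpath (cnj a) b) ?K =
      contour_integral (linepath (cnj a) (cnj b)) ?K + contour_integral (linepath (cnj b) b) ?K
      + contour_integral (linepath b a) ?K + contour_integral (linepath a (cnj a)) ?K"
    unfolding rectpath_def Let_def corners using cont
    by (simp add: contour_integrable_continuous_linepath add_ac)
  also have "contour_integral (linepath (cnj b) b) ?K =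
      contour_integral (linepath (cnj b) b0) ?K + contour_integral (linepath b0 b) ?K"
    by (rule contour_integral_split_linepath[OF cont(3) mid(2)])
  also have "contour_integral (linepath a (cnj a)) ?K =
      contour_integral (linepath a a0) ?K + contour_integral (linepath a0 (cnj a)) ?K"
    by (rule contour_integral_split_linepath[OF cont(1) mid(1)])
  also have "contour_integral (linepath (cnj a) (cnj b)) ?K = - cnj (contour_integral (linepath b a) ?K)"
    using contour_integral_reverse_linepath[OF cont(5)] by (simp add: contour_integral_kernel_cnj)
  also have "contour_integral (linepath (cnj b) b0) ?K = - cnj (contour_integral (linepath b0 b) ?K)"
    using contour_integral_reverse_linepath[of b b0 ?K] contour_integral_kernel_cnj[of b b0 p t]
      continuous_on_subset[OF cont(3) sub(1)] by (simp add: real_pts)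
  also have "contour_integral (linepath a0 (cnj a)) ?K = - cnj (contour_integral (linepath a a0) ?K)"
    using contour_integral_reverse_linepath[of a a0 ?K] contour_integral_kernel_cnj[of a0 a p t]
      continuous_on_subset[OF cont(1) sub(2)] by (simp add: real_pts)
  finally have "contour_integral (rectpath (cnj a) b) ?K =
      upper_contour p (of_real t) N - cnj (upper_contour p (of_real t) N)"
    by (simp add: upper_contour_def a_def b_def a0_def b0_def)
  also have "\<dots> = 2 * \<i> * of_real (Im (upper_contour p (of_real t) N))"
    by (simp add: complex_eq_iff)
  also have "cnj a = Complex (1/4) (- real N)"
    by (simp add: a_def complex_eq_iff)
  finally show ?thesis
    by (simp only: b_def)
qed

lemma partial_sum_eq_Im_upper_contour:
  assumes "p > 0" "real N \<ge> p" "N \<ge> 1"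
  shows "(\<Sum>j<N. of_real (weight p (pos_root p j)) * exp (- of_real (pos_root p j) * of_real t))
     = complex_of_real (Im (upper_contour p (of_real t) N))"
  using contour_integral_kernel_rectpath[OF assms, of "of_real t"] contour_integral_kernel_fold[OF assms, of t]
  by simp

lemma contour_integral_exp_line:
  assumes "t \<noteq> 0"
  shows "((\<lambda>s. - \<i> * exp (- (s * t))) has_contour_integral
     (\<i> * exp (- (b * t)) / t - \<i> * exp (- (a * t)) / t)) (linepath a b)"
proof -
  have "((\<lambda>s. - \<i> * exp (- (s * t))) has_contour_integral
     (\<i> * exp (- (pathfinish (linepath a b) * t)) / t - \<i> * exp (- (pathstart (linepath a b) * t)) / t))
     (linepath a b)"
  proof (rule contour_integral_primitive[where S = UNIV])
    show "((\<lambda>s. \<i> * exp (- (s * t)) / t) has_field_derivative - \<i> * exp (- (s * t))) (at s within UNIV)"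
      for s
      by (rule derivative_eq_intros refl)+ (use assms in \<open>auto simp: field_simps\<close>)
  qed auto
  then show ?thesis
    by simp
qed

lemma remainder_holomorphic:
  assumes "\<And>s. s \<in> A \<Longrightarrow> crobin p s \<noteq> 0"
  shows "remainder p holomorphic_on A"
proof -
  have "incoming p holomorphic_on A"
    unfolding incoming_def [abs_def] by (intro holomorphic_intros)
  then show ?thesis
    unfolding remainder_def [abs_def] using assms by (intro holomorphic_intros crobin_holomorphic) auto
qed

lemma damped_holomorphic:
  assumes "\<And>s. s \<in> A \<Longrightarrow> crobin p s \<noteq> 0"
  shows "damped p t holomorphic_on A"
  unfolding damped_def [abs_def] using assms by (intro holomorphic_intros remainder_holomorphic) auto

lemma kernel_eq_damped:
  assumes "crobin p s \<noteq> 0"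
  shows "robin_kernel p t s = - \<i> * exp (- (s * t)) + damped p t s"
proof -
  have "robin_kernel p t s = drobin p s / crobin p s * exp (- (s * t))"
    by (simp add: robin_kernel_def)
  then show ?thesis
    by (simp only: drobin_over_crobin[OF assms] damped_def distrib_right)
qed

text \<open>
  The non-decaying part \<open>- \<i> e\<^sup>-\<^sup>s\<^sup>t\<close> is integrated exactly. Along the upper contour these terms
  telescope.
\<close>

lemma contour_integral_kernel_line:
  assumes t: "t \<noteq> 0" and nz: "\<And>s. s \<in> closed_segment a b \<Longrightarrow> crobin p s \<noteq> 0"
  shows "contour_integral (linepath a b) (robin_kernel p t) =
     \<i> * exp (- (b * t)) / t - \<i> * exp (- (a * t)) / t + contour_integral (linepath a b) (damped p t)"
proof -
  have "damped p t contour_integrable_on linepath a b"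
    using nz by (intro contour_integrable_continuous_linepath holomorphic_on_imp_continuous_on damped_holomorphic)
  then have "((\<lambda>s. - \<i> * exp (- (s * t)) + damped p t s) has_contour_integral
     (\<i> * exp (- (b * t)) / t - \<i> * exp (- (a * t)) / t + contour_integral (linepath a b) (damped p t)))
     (linepath a b)"
    by (intro has_contour_integral_add contour_integral_exp_line t has_contour_integral_integral)
  moreover have "contour_integral (linepath a b) (robin_kernel p t) =
     contour_integral (linepath a b) (\<lambda>s. - \<i> * exp (- (s * t)) + damped p t s)"
    by (rule contour_integral_cong) (use nz kernel_eq_damped in auto)
  ultimately show ?thesis
    by (simp only: contour_integral_unique)
qed

lemma contour_integral_line_parameter_holomorphic:
  assumes u: "continuous_on (closed_segment a b) u"
  shows "(\<lambda>t. contour_integral (linepath a b) (\<lambda>s. u s * exp (- (s * t)))) holomorphic_on UNIV"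
proof -
  let ?l = "linepath a b"
  have ul: "continuous_on {0..1} (\<lambda>x. u (?l x))"
    using continuous_on_compose[of "{0..1}" ?l u] u
    by (simp add: linepath_image_01 o_def continuous_on_linepath)
  have "(\<lambda>t. integral (cbox 0 1) (\<lambda>x. u (?l x) * exp (- (?l x * t)) * (b - a))) holomorphic_on UNIV"
  proof (rule leibniz_rule_holomorphic)
    show "((\<lambda>t. u (?l x) * exp (- (?l x * t)) * (b - a)) has_field_derivative
       u (?l x) * (- ?l x * exp (- (?l x * t))) * (b - a)) (at t within UNIV)" for t x
      by (rule derivative_eq_intros refl)+ simp
    show "(\<lambda>x. u (?l x) * exp (- (?l x * t)) * (b - a)) integrable_on cbox 0 1" for t
      by (intro integrable_continuous) (auto intro!: continuous_intros ul continuous_on_linepath)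
    have "continuous_on (UNIV \<times> {0..1}) (\<lambda>y::complex \<times> real. u (?l (snd y)))"
      by (rule continuous_on_compose2[OF ul]) (auto intro!: continuous_on_snd continuous_on_id)
    moreover have "continuous_on (UNIV \<times> {0..1}) (\<lambda>y::complex \<times> real. ?l (snd y))"
      unfolding linepath_def by (intro continuous_intros)
    ultimately show "continuous_on (UNIV \<times> cbox 0 1)
        (\<lambda>(t, x). u (?l x) * (- ?l x * exp (- (?l x * t))) * (b - a))"
      by (auto simp: case_prod_unfold intro!: continuous_intros)
  qed auto
  then show ?thesis
    by (simp add: contour_integral_integral)
qed

section \<open>The limit of the contour integrals\<close>

definition strip_integral :: "real \<Rightarrow> nat \<Rightarrow> complex \<Rightarrow> complex" where
  "strip_integral p n t =
     contour_integral (linepath (Complex (1/4) (real n)) (Complex (1/4) (real n + 1))) (damped p t)"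

text \<open>
  The integral of \<open>damped p t\<close> over the ray from \<open>1/4\<close> to \<open>1/4 + \<i> \<infinity>\<close>, cut into strips of height \<open>1\<close>
  so that the Weierstrass test applies.
\<close>

definition ray_integral :: "real \<Rightarrow> complex \<Rightarrow> complex" where
  "ray_integral p t = (\<Sum>n. strip_integral p n t)"

lemma damped_continuous:
  assumes "\<And>s. s \<in> A \<Longrightarrow> crobin p s \<noteq> 0"
  shows "continuous_on A (damped p t)"
  using assms by (intro holomorphic_on_imp_continuous_on damped_holomorphic)

lemma crobin_nonzero_quarter:
  "p > 0 \<Longrightarrow> Re s = 1 / 4 \<Longrightarrow> crobin p s \<noteq> 0"
  by (rule crobin_nonzero) auto

lemma strip_integral_holomorphic:
  assumes "p > 0"
  shows "strip_integral p n holomorphic_on UNIV"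
  unfolding strip_integral_def [abs_def] damped_def [abs_def]
  by (intro contour_integral_line_parameter_holomorphic holomorphic_on_imp_continuous_on
        remainder_holomorphic crobin_nonzero_quarter assms) (auto simp: closed_segment_same_Re)

text \<open>
  On the ray the remainder is at most \<open>4 e\<^sup>-\<^sup>2\<^sup>\<pi>\<^sup>y\<close>, while \<open>e\<^sup>-\<^sup>s\<^sup>t\<close> is at most \<open>e\<^sup>1\<^sup>/\<^sup>4\<^sup>+\<^sup>y\<close> for
  \<open>|t| \<le> 1\<close>; and \<open>2\<pi> - 1 > 5\<close>.
\<close>

lemma norm_strip_integral_le:
  assumes p: "p > 0" and t: "norm t \<le> 1"
  shows "norm (strip_integral p n t) \<le> 4 * exp (1 / 4) * exp (- 5) ^ n"
proof -
  let ?a = "Complex (1/4) (real n)" and ?b = "Complex (1/4) (real n + 1)"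
  have "norm (strip_integral p n t) \<le> (4 * exp (1 / 4) * exp (- 5 * real n)) * norm (?b - ?a)"
    unfolding strip_integral_def
  proof (rule contour_integral_bound_linepath)
    show "damped p t contour_integrable_on linepath ?a ?b"
      by (intro contour_integrable_continuous_linepath damped_continuous crobin_nonzero_quarter p)
         (auto simp: closed_segment_same_Re)
    fix s assume "s \<in> closed_segment ?a ?b"
    then have s: "Re s = 1 / 4" "real n \<le> Im s"
      by (auto simp: closed_segment_same_Re closed_segment_eq_real_ivl)
    have "norm s \<le> 1 / 4 + Im s"
      using cmod_le[of s] s by simp
    then have "norm s * norm t \<le> 1 / 4 + Im s"
      using mult_left_mono[OF t, of "norm s"] by simp
    then have "norm (exp (- (s * t))) \<le> exp (1 / 4 + Im s)"
      using norm_exp[of "- (s * t)"] by (simp add: norm_mult order_trans[OF _ exp_le_cancel_iff[THEN iffD2]])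
    moreover have "norm (remainder p s) \<le> 4 * exp (- 2 * pi * Im s)"
      using remainder_bound_quarter(2)[of p s] p s by simp
    ultimately have "norm (damped p t s) \<le> 4 * exp (- 2 * pi * Im s) * exp (1 / 4 + Im s)"
      unfolding damped_def norm_mult by (intro mult_mono) auto
    also have "\<dots> = 4 * exp (1 / 4 + (1 - 2 * pi) * Im s)"
      by (simp add: algebra_simps flip: exp_add)
    also have "\<dots> \<le> 4 * exp (1 / 4 - 5 * real n)"
    proof -
      have "(1 - 2 * pi) * Im s \<le> (- 5) * Im s"
        using pi_gt3 s by (intro mult_right_mono) auto
      then show ?thesis
        using s by simp
    qed
    also have "\<dots> = 4 * exp (1 / 4) * exp (- 5 * real n)"
      by (simp flip: exp_add)
    finally show "norm (damped p t s) \<le> 4 * exp (1 / 4) * exp (- 5 * real n)" .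
  qed simp
  also have "norm (?b - ?a) = 1"
    by (simp add: cmod_def)
  also have "exp (- 5 * real n) = exp (- 5) ^ n"
    by (simp only: mult.commute[of "- 5" "real n"] exp_of_nat_mult)
  finally show ?thesis
    by simp
qed

lemma summable_strip_bound: "summable (\<lambda>n. 4 * exp (1 / 4) * exp (- 5) ^ n :: real)"
  by (intro summable_mult summable_geometric) simp

lemma ray_integral_holomorphic:
  assumes p: "p > 0"
  shows "ray_integral p holomorphic_on ball 0 1"
proof (rule holomorphic_uniform_sequence)
  show "(\<lambda>t. \<Sum>n<N. strip_integral p n t) holomorphic_on ball 0 1" for N
    by (intro holomorphic_on_sum holomorphic_on_subset[OF strip_integral_holomorphic] p) auto
  fix t :: complex assume "t \<in> ball 0 1"
  then obtain d where d: "d > 0" "cball t d \<subseteq> ball 0 1"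
    by (metis open_ball open_contains_cball)
  have "uniform_limit (cball t d) (\<lambda>N t. \<Sum>n<N. strip_integral p n t) (ray_integral p) sequentially"
    unfolding ray_integral_def [abs_def]
  proof (rule Weierstrass_m_test)
    show "norm (strip_integral p n w) \<le> 4 * exp (1 / 4) * exp (- 5) ^ n" if "w \<in> cball t d" for n w
    proof (rule norm_strip_integral_le[OF p])
      have "w \<in> ball 0 1"
        using that d by blast
      then show "norm w \<le> 1"
        by simp
    qed
  qed (rule summable_strip_bound)
  with d show "\<exists>d>0. cball t d \<subseteq> ball 0 1 \<and>
      uniform_limit (cball t d) (\<lambda>N t. \<Sum>n<N. strip_integral p n t) (ray_integral p) sequentially"
    by blast
qed auto

lemma sum_strip_integral:
  assumes p: "p > 0"
  shows "(\<Sum>n<N. strip_integral p n t) =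
    contour_integral (linepath (1/4) (Complex (1/4) (real N))) (damped p t)"
proof (induction N)
  case 0
  have "Complex (1/4) 0 = 1/4"
    by (simp add: complex_eq_iff)
  then show ?case
    by (simp only: of_nat_0 lessThan_0 sum.empty contour_integral_trivial)
next
  case (Suc N)
  let ?q = "\<lambda>y. Complex (1/4) y"
  have quarter: "1 / 4 = ?q 0"
    by (simp add: complex_eq_iff)
  have "contour_integral (linepath (?q 0) (?q (real (Suc N)))) (damped p t) =
      contour_integral (linepath (?q 0) (?q (real N))) (damped p t)
      + contour_integral (linepath (?q (real N)) (?q (real (Suc N)))) (damped p t)"
  proof (rule contour_integral_split_linepath)
    show "continuous_on (closed_segment (?q 0) (?q (real (Suc N)))) (damped p t)"
      by (intro damped_continuous crobin_nonzero_quarter p) (auto simp: closed_segment_same_Re)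
  qed (auto simp: closed_segment_same_Re closed_segment_eq_real_ivl)
  then show ?case
    using Suc by (simp add: strip_integral_def quarter add.commute)
qed

text \<open>
  On the right side \<open>e\<^sup>-\<^sup>s\<^sup>t\<close> is as small as \<open>e\<^sup>-\<^sup>N\<^sup>t\<close>, and on the top the remainder is as small as
  \<open>e\<^sup>-\<^sup>2\<^sup>\<pi>\<^sup>N\<close>; both beat the side length \<open>N\<close>.
\<close>

lemma upper_contour_limit:
  assumes p: "p > 0" and t: "0 < t" "t < 1"
  shows "(\<lambda>N. upper_contour p (of_real t) N) \<longlonglongrightarrow>
    \<i> * exp (- (1/4 * of_real t)) / of_real t - ray_integral p (of_real t)"
proof -
  let ?t = "complex_of_real t"
  let ?F = "\<lambda>s. \<i> * exp (- (s * ?t)) / ?t"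
  let ?b = "\<lambda>N. Complex (real N) (real N)" and ?a = "\<lambda>N. Complex (1/4) (real N)"
  define right where "right N = contour_integral (linepath (of_nat N) (?b N)) (damped p ?t)" for N
  define top where "top N = contour_integral (linepath (?b N) (?a N)) (damped p ?t)" for N
  obtain N0 :: nat where N0: "real N0 \<ge> p" "N0 \<ge> 1"
    using real_arch_simple[of "max p 1"] by auto
  (* The exact terms of the three sides telescope to a difference of values at 1/4 and N. *)
  have split: "upper_contour p ?t N = ?F (1/4) - ?F (of_nat N) + right N + top N
      - (\<Sum>n<N. strip_integral p n ?t)" if "N \<ge> N0" for N
  proof -
    have N: "real N \<ge> p" "N \<ge> 1"
      using that N0 by auto
    have nz: "crobin p s \<noteq> 0"
      if "s \<in> closed_segment (of_nat N) (?b N) \<or> s \<in> closed_segment (?b N) (?a N)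
        \<or> s \<in> closed_segment (?a N) (1/4)" for s
    proof (rule crobin_nonzero[OF p])
      show "Re s = 1 / 4 \<or> (\<exists>M. Re s = real M \<and> p \<le> real M) \<or> Im s \<noteq> 0"
        using that N by (auto simp: closed_segment_same_Re closed_segment_same_Im)
    qed
    have "contour_integral (linepath (?a N) (1/4)) (damped p ?t) =
        - (\<Sum>n<N. strip_integral p n ?t)"
      unfolding sum_strip_integral[OF p] using nz
      by (intro contour_integral_reverse_linepath damped_continuous) auto
    then show ?thesis
      unfolding upper_contour_def right_def top_def using t nz
      by (simp add: contour_integral_kernel_line)
  qed
  have null: "(\<lambda>N. real N * exp (- r * real N)) \<longlonglongrightarrow> 0" if "r > 0" for r
  proof -
    have "(\<lambda>N. of_nat N * exp (- r) ^ N) \<longlonglongrightarrow> 0"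
      using that by (intro powser_times_n_limit_0) simp
    moreover have "exp (- r * real N) = exp (- r) ^ N" for N
      by (simp only: mult.commute[of "- r" "real N"] exp_of_nat_mult)
    ultimately show ?thesis
      by simp
  qed
  have right: "right \<longlonglongrightarrow> 0"
  proof (rule Lim_null_comparison)
    show "(\<lambda>N. 4 * (real N * exp (- t * real N))) \<longlonglongrightarrow> 0"
      using tendsto_mult_left[OF null[OF t(1)], of 4] by simp
    show "\<forall>\<^sub>F N in sequentially. norm (right N) \<le> 4 * (real N * exp (- t * real N))"
    proof (rule eventually_sequentiallyI)
      fix N assume "N \<ge> N0"
      then have N: "real N \<ge> p" "N \<ge> 1"
        using N0 by auto
      have "norm (right N) \<le> (4 * exp (- t * real N)) * norm (?b N - of_nat N)"
        unfolding right_def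
      proof (rule contour_integral_bound_linepath)
        show "damped p ?t contour_integrable_on linepath (of_nat N) (?b N)"
        proof (intro contour_integrable_continuous_linepath damped_continuous crobin_nonzero[OF p])
          fix s assume "s \<in> closed_segment (of_nat N) (?b N)"
          then show "Re s = 1 / 4 \<or> (\<exists>M. Re s = real M \<and> p \<le> real M) \<or> Im s \<noteq> 0"
            using N by (auto simp: closed_segment_same_Re)
        qed
        fix s assume "s \<in> closed_segment (of_nat N) (?b N)"
        then have s: "Re s = real N" "Im s \<ge> 0"
          by (auto simp: closed_segment_same_Re closed_segment_eq_real_ivl)
        have "norm (remainder p s) \<le> 4 * exp (- 2 * pi * Im s)"
          using remainder_bound_nat(2)[of p s N] p s N by simp
        also have "\<dots> \<le> 4"
          using s by simp
        finally show "norm (damped p ?t s) \<le> 4 * exp (- t * real N)"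
          using s by (simp add: damped_def norm_mult mult.commute)
      qed simp
      also have "norm (?b N - of_nat N) = real N"
        by (simp add: cmod_def)
      finally show "norm (right N) \<le> 4 * (real N * exp (- t * real N))"
        by (simp add: mult_ac)
    qed
  qed
  have top: "top \<longlonglongrightarrow> 0"
  proof (rule Lim_null_comparison)
    show "(\<lambda>N. 4 * (real N * exp (- (2 * pi) * real N))) \<longlonglongrightarrow> 0"
      using tendsto_mult_left[OF null[of "2 * pi"], of 4] by simp
    show "\<forall>\<^sub>F N in sequentially. norm (top N) \<le> 4 * (real N * exp (- (2 * pi) * real N))"
    proof (rule eventually_sequentiallyI)
      fix N assume "N \<ge> N0"
      then have N: "N \<ge> 1"
        using N0 by auto
      have seg: "Im s = real N \<and> Re s \<ge> 0" if "s \<in> closed_segment (?b N) (?a N)" for s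
        using that N by (auto simp: closed_segment_same_Im closed_segment_eq_real_ivl split: if_splits)
      have "norm (top N) \<le> (4 * exp (- (2 * pi) * real N)) * norm (?a N - ?b N)"
        unfolding top_def
      proof (rule contour_integral_bound_linepath)
        show "damped p ?t contour_integrable_on linepath (?b N) (?a N)"
          using seg N
          by (intro contour_integrable_continuous_linepath damped_continuous crobin_nonzero[OF p]) auto
        fix s assume "s \<in> closed_segment (?b N) (?a N)"
        then have s: "Im s = real N" "Re s \<ge> 0"
          using seg by auto
        have "norm (remainder p s) \<le> 4 * exp (- 2 * pi * Im s)"
          using remainder_bound_upper(2)[of p s] p s N by simp
        moreover have "norm (exp (- (s * ?t))) \<le> 1"
          using s t by simp
        ultimately show "norm (damped p ?t s) \<le> 4 * exp (- (2 * pi) * real N)"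
          unfolding damped_def norm_mult using s
          using mult_mono[of "norm (remainder p s)" "4 * exp (- 2 * pi * Im s)" "norm (exp (- (s * ?t)))" 1]
          by simp
      qed simp
      also have "norm (?a N - ?b N) = real N - 1 / 4"
        using N by (simp add: cmod_def)
      also have "(4 * exp (- (2 * pi) * real N)) * (real N - 1 / 4) \<le> (4 * exp (- (2 * pi) * real N)) * real N"
        by (intro mult_left_mono) auto
      finally show "norm (top N) \<le> 4 * (real N * exp (- (2 * pi) * real N))"
        by (simp add: mult_ac)
    qed
  qed
  have far: "(\<lambda>N. ?F (of_nat N)) \<longlonglongrightarrow> 0"
  proof -
    have "(\<lambda>N. exp (- ?t) ^ N) \<longlonglongrightarrow> 0"
      using t by (intro LIMSEQ_power_zero) simp
    then have "(\<lambda>N. exp (- (of_nat N * ?t))) \<longlonglongrightarrow> 0"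
      by (simp flip: exp_of_nat_mult)
    then show ?thesis
      using tendsto_mult_left[of "\<lambda>N. exp (- (of_nat N * ?t))" 0 sequentially "\<i> / ?t"]
      by simp
  qed
  have ray: "(\<lambda>N. \<Sum>n<N. strip_integral p n ?t) \<longlonglongrightarrow> ray_integral p ?t"
  proof -
    have "summable (\<lambda>n. strip_integral p n ?t)"
      by (rule summable_comparison_test[OF _ summable_strip_bound])
         (use norm_strip_integral_le[OF p, of ?t] t in auto)
    then show ?thesis
      unfolding ray_integral_def by (rule summable_LIMSEQ)
  qed
  have "(\<lambda>N. ?F (1/4) - ?F (of_nat N) + right N + top N - (\<Sum>n<N. strip_integral p n ?t))
      \<longlonglongrightarrow> ?F (1/4) - 0 + 0 + 0 - ray_integral p ?t"
    by (intro tendsto_intros far right top ray)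
  then have "upper_contour p ?t \<longlonglongrightarrow> ?F (1/4) - 0 + 0 + 0 - ray_integral p ?t"
    by (rule Lim_transform_eventually)
       (auto intro!: eventually_sequentiallyI[of N0] simp: split)
  then show ?thesis
    by simp
qed

section \<open>The second kind: existence of the generating function\<close>

text \<open>
  The holomorphic extension of \<open>t \<sigma>\<^sub>p(t)\<close>: the quotient by \<open>2 \<i>\<close> is the imaginary part of the ray
  integral at real \<open>t\<close>, written so that it is holomorphic in \<open>t\<close>.
\<close>

definition sigma_p_regular :: "real \<Rightarrow> complex \<Rightarrow> complex" where
  "sigma_p_regular p t =
     exp (- (1/4 * t)) - t * ((ray_integral p t - cnj (ray_integral p (cnj t))) / (2 * \<i>))"

lemma sigma_p_regular_holomorphic:
  assumes "p > 0"
  shows "sigma_p_regular p holomorphic_on ball 0 1"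
proof -
  have "cnj ` ball 0 1 \<subseteq> ball 0 1"
    by auto
  then have "ray_integral p holomorphic_on cnj ` ball 0 1"
    using ray_integral_holomorphic[OF assms] by (rule holomorphic_on_subset[rotated])
  then have "(\<lambda>t. cnj (ray_integral p (cnj t))) holomorphic_on ball 0 1"
    using holomorphic_on_compose_cnj_cnj[of "ray_integral p" "ball 0 1"] by (simp add: o_def)
  then show ?thesis
    unfolding sigma_p_regular_def [abs_def]
    by (intro holomorphic_intros ray_integral_holomorphic assms) auto
qed

lemma sigma_p_eq_regular:
  assumes p: "p > 0" and t: "0 < t" "t < 1"
  shows "of_real t * sigma_p p (of_real t) = sigma_p_regular p (of_real t)"
proof -
  let ?t = "complex_of_real t"
  let ?term = "\<lambda>j. of_real (weight p (pos_root p j)) * exp (- of_real (pos_root p j) * ?t)"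
  let ?L = "\<i> * exp (- (1/4 * ?t)) / ?t - ray_integral p ?t"
  obtain N0 :: nat where N0: "real N0 \<ge> p" "N0 \<ge> 1"
    using real_arch_simple[of "max p 1"] by auto
  have "(\<lambda>N. complex_of_real (Im (upper_contour p ?t N))) \<longlonglongrightarrow> of_real (Im ?L)"
    by (intro tendsto_of_real tendsto_Im upper_contour_limit assms)
  moreover have "\<forall>\<^sub>F N in sequentially. complex_of_real (Im (upper_contour p ?t N)) = (\<Sum>j<N. ?term j)"
  proof (rule eventually_sequentiallyI)
    fix N assume "N \<ge> N0"
    then show "complex_of_real (Im (upper_contour p ?t N)) = (\<Sum>j<N. ?term j)"
      using N0 by (intro partial_sum_eq_Im_upper_contour[symmetric] p) auto
  qed
  ultimately have "(\<lambda>N. \<Sum>j<N. ?term j) \<longlonglongrightarrow> of_real (Im ?L)"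
    by (rule Lim_transform_eventually)
  then have "?term sums of_real (Im ?L)"
    by (simp add: sums_def)
  then have "sigma_p p ?t = of_real (Im ?L)"
    unfolding sigma_p_def weight_def by (rule sums_unique[symmetric])
  moreover have "Im ?L = exp (- (1/4 * t)) / t - Im (ray_integral p ?t)"
  proof -
    have "exp (- (1/4 * ?t)) = complex_of_real (exp (- (1/4 * t)))"
      by (simp flip: exp_of_real)
    then show ?thesis
      by simp
  qed
  moreover have "(ray_integral p ?t - cnj (ray_integral p (cnj ?t))) / (2 * \<i>) = of_real (Im (ray_integral p ?t))"
    by (simp add: complex_eq_iff)
  ultimately show ?thesis
    using t by (simp add: sigma_p_regular_def right_diff_distrib flip: exp_of_real)
qed

text \<open>
  This makes the coefficient sequence described by \<open>p_bernoulli2\<close> unique: a nonzero power series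
  has no zeros accumulating at \<open>0\<close>.
\<close>

lemma power_series_zero_on_interval:
  fixes d :: "nat \<Rightarrow> complex"
  assumes "\<And>t::real. 0 < t \<Longrightarrow> t < 1 \<Longrightarrow> (\<lambda>n. d n * of_real t ^ n) sums 0"
  shows "d n = 0"
proof -
  define F where "F = Abs_fps d"
  have "summable (\<lambda>n. d n * of_real (1/2) ^ n)"
    using assms[of "1/2"] by (intro sums_summable) auto
  then have radius: "conv_radius d \<ge> ereal (norm (complex_of_real (1/2)))"
    by (rule conv_radius_geI)
  have "(0::ereal) < ereal (norm (complex_of_real (1/2)))"
    by simp
  also note radius
  finally have "fps_conv_radius F > 0"
    by (simp add: F_def fps_conv_radius_def)
  then have F: "eval_fps F has_laurent_expansion fps_to_fls F"
    by (intro has_laurent_expansion_fps eval_fps_has_fps_expansion)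
  have zero: "eval_fps F (of_real t) = 0" if "0 < t" "t < 1" for t :: real
    using sums_unique[OF assms[OF that]] by (simp add: eval_fps_def F_def)
  have "F = 0"
  proof (rule ccontr)
    assume "F \<noteq> 0"
    then have "\<forall>\<^sub>F z in at 0. eval_fps F z \<noteq> 0"
      using has_laurent_expansion_nonzero_imp_eventually_nonzero[OF F] by simp
    then obtain e where e: "e > 0" "\<And>z. z \<noteq> 0 \<Longrightarrow> norm z < e \<Longrightarrow> eval_fps F z \<noteq> 0"
      by (auto simp: eventually_at)
    define r where "r = min e 1 / 2"
    have r: "0 < r" "r < 1" "r < e"
      using e(1) by (auto simp: r_def min_def)
    then have "eval_fps F (of_real r) \<noteq> 0"
      by (intro e(2)) auto
    then show False
      using zero r by simp
  qed
  then show ?thesis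
    by (simp add: F_def fps_eq_iff)
qed

text \<open>
  The Taylor coefficients of \<open>sigma_p_regular\<close> satisfy the defining property of the numbers of the
  second kind on \<open>(0, 1)\<close>, and are the only ones to do so.
\<close>

lemma egf_second_kind:
  assumes p: "p > 0"
  shows "sigma_p_regular p has_fps_expansion egf 2 p"
proof -
  let ?B = "\<lambda>n. (deriv ^^ n) (sigma_p_regular p) 0"
  have B: "(\<lambda>n. ?B n / fact n * of_real t ^ n) sums (of_real t * sigma_p p (of_real t))"
    if "0 < t" "t < 1" for t :: real
    using holomorphic_power_series[OF sigma_p_regular_holomorphic[OF p], of "of_real t"] that
    by (simp add: sigma_p_eq_regular[OF p])
  have "p_bernoulli2 p = ?B"
    unfolding p_bernoulli2_def
  proof (rule the_equality)
    show "\<forall>t::real. 0 < t \<and> t < 1 \<longrightarrow>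
        (\<lambda>n. ?B n / fact n * of_real t ^ n) sums (of_real t * sigma_p p (of_real t))"
      using B by blast
    fix B' :: "nat \<Rightarrow> complex"
    assume B': "\<forall>t::real. 0 < t \<and> t < 1 \<longrightarrow>
        (\<lambda>n. B' n / fact n * of_real t ^ n) sums (of_real t * sigma_p p (of_real t))"
    have "(B' n - ?B n) / fact n = 0" for n
    proof (rule power_series_zero_on_interval)
      fix t :: real assume t: "0 < t" "t < 1"
      have "(\<lambda>n. B' n / fact n * of_real t ^ n - ?B n / fact n * of_real t ^ n) sums
          (of_real t * sigma_p p (of_real t) - of_real t * sigma_p p (of_real t))"
        using B' B t by (intro sums_diff) auto
      then show "(\<lambda>n. (B' n - ?B n) / fact n * of_real t ^ n) sums 0"
        by (simp add: diff_divide_distrib left_diff_distrib)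
    qed
    then show "B' = ?B"
      by (auto simp: fun_eq_iff)
  qed
  then have "egf 2 p = fps_expansion (sigma_p_regular p) 0"
    by (simp add: egf_def p_bernoulli_def fps_expansion_def)
  then show ?thesis
    using has_fps_expansion_fps_expansion[of "ball 0 1"] sigma_p_regular_holomorphic[OF p] by simp
qed

lemma E_coeff_second_kind:
  assumes "p > 0" "k \<ge> 1" "x \<noteq> 0" "x \<noteq> 1"
  shows "P_fun 2 p k x - P_fun 2 p k (x - 1) + x ^ (2 * k - 2) * P_fun 2 p k ((x - 1) / x)
         = E_coeff 2 p k x"
proof -
  have "eval_fps (egf 2 p) has_fps_expansion egf 2 p"
    using egf_second_kind[OF assms(1)] by (auto simp: has_fps_expansion_def)
  then obtain H where H:
    "three_term (\<lambda>t. eval_fps (egf 2 p) t / t) x has_laurent_expansion fps_to_fls H"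
    "fps_nth H (2 * k) = P_fun 2 p k x - P_fun 2 p k (x - 1)
       + x ^ (2 * k - 2) * P_fun 2 p k ((x - 1) / x)"
    by (rule three_term_expansion[OF _ assms(3,4,2)]) (rule that)
  have "sigma_p_cont p t = eval_fps (egf 2 p) t / t" for t
    by (simp add: sigma_p_cont_def eval_fps_def egf_def p_bernoulli_def)
  then have "E_gen 2 p x = three_term (\<lambda>t. eval_fps (egf 2 p) t / t) x"
    by (simp add: fun_eq_iff E_gen_def E2_gen_def three_term_def)
  then have "laurent_expansion (E_gen 2 p x) 0 = fps_to_fls H"
    using H(1) by (intro laurent_expansion_0_eqI) simp
  then show ?thesis
    using H(2) by (simp add: E_coeff_def nat_mult_distrib)
qed

theorem theorem2p8:
  fixes p :: real and l k :: nat
  assumes "p > 0" and "l \<in> {1, 2}" and "k > 2"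
  shows "(\<forall>z::complex. z \<noteq> 0 \<longrightarrow>
            P_fun l p k z - z ^ (2*k - 2) * P_fun l p k (1 / z) = 0) \<and>
         (\<forall>z::complex. z \<noteq> 0 \<and> z \<noteq> 1 \<longrightarrow>
            P_fun l p k z - P_fun l p k (z - 1) + z ^ (2*k - 2) * P_fun l p k ((z - 1) / z)
              = E_coeff l p k z)"
proof (intro conjI allI impI)
  fix z :: complex assume "z \<noteq> 0"
  then show "P_fun l p k z - z ^ (2*k - 2) * P_fun l p k (1 / z) = 0"
    using assms(3) by (intro P_fun_reciprocal) auto
next
  fix z :: complex assume z: "z \<noteq> 0 \<and> z \<noteq> 1"
  show "P_fun l p k z - P_fun l p k (z - 1) + z ^ (2*k - 2) * P_fun l p k ((z - 1) / z)
      = E_coeff l p k z"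
  proof (cases "l = 1")
    case True
    then show ?thesis
      using E_coeff_first_kind[of p k z] assms z by simp
  next
    case False
    then have "l = 2"
      using assms(2) by simp
    then show ?thesis
      using E_coeff_second_kind[of p k z] assms z by simp
  qed
qed

end
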